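(* Let $\alpha\in I[a,b]$ with reduced saltus decomposition $\alpha=G\alpha+S_L\alpha+S_R\alpha$, and let $\{(x_i,a_i)\}$ and $\{(y_i,b_i)\}$ be the reduced saltus sets of $S_L\alpha$ and $S_R\alpha$ respectively. Then for any $f\in B[a,b]$, the following are equivalent: (1) $f\in DS_\alpha[a,b]$ and $\displaystyle (RDS)\int_a^b f(x)\,d\alpha=(DS)\int_a^b f(x)\,d\alpha$; (2) $f\in RDS_\alpha[a,b]$, the one-sided limits $f(x_i+)$ and $f(y_i-)$ exist for all $i$, and $$\sum_{i=1}^\infty a_i[f(x_i)-f(x_i+)]+\sum_{i=1}^\infty b_i[f(y_i)-f(y_i-)]=0 .$$
   Context: Fix reals $a<b$. $B[a,b]$ and $I[a,b]$ denote the bounded and the increasing (nondecreasing) real functions on $[a,b]$. $\alpha(x\pm)$ are one-sided limits, with the convention $\alpha(a-)=\alpha(a)$, $\alpha(b+)=\alpha(b)$. A partition is $\mathcal P=\{x_i\}_{i=0}^n$ with $a=x_0<\dots<x_n=b$; $I_i=(x_{i-1},x_i)$. Set $\mu_\alpha((c,d))=\alpha(d-)-\alpha(c+)$ and $\mu_\alpha(\{c\})=\alpha(c+)-\alpha(c-)$. A step function $u\in S[a,b]$ is a bounded function which, for some partition, equals a constant $c_i$ on each $I_i$ (values at partition points arbitrary). Its RDS integral is $\sum_{i=0}^n u(x_i)\mu_\alpha(\{x_i\})+\sum_{i=1}^n c_i\mu_\alpha(I_i)$, and its (interior) DS integral is $\sum_{i=1}^n c_i[\alpha(x_i)-\alpha(x_{i-1})]$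 (both independent of the partition). For $\alpha\in I[a,b]$ and $f\in B[a,b]$, consider the supremum of the integrals of all step functions $v\le f$ and the infimum of the integrals of all step functions $u\ge f$ on $[a,b]$. If these coincide using RDS integrals of step functions, write $f\in RDS_\alpha[a,b]$ and call the common value $(RDS)\int_a^b f\,d\alpha$; if they coincide using DS integrals of step functions, write $f\in DS_\alpha[a,b]$ and call the common value $(DS)\int_a^b f\,d\alpha$. It is known that $DS_\alpha[a,b]\subset RDS_\alpha[a,b]$, so both integrals in (1) make sense. Reduced saltus decomposition: let $\{t_i\}$ be the countable set of discontinuities of $\alpha$; $H_0(x)=1$ for $x>0$ and $0$ for $x\le0$; $H_1(x)=1$ for $x\ge0$ and $0$ for $x<0$. Then $S_L\alpha(x)=\sum_i(\alpha(t_i+)-\alpha(t_i))H_0(x-t_i)$, $S_R\alpha(x)=\sum_i(\alpha(t_i)-\alpha(t_i-))H_1(x-t_i)$, and $G\alpha=\alpha-S_L\alpha-S_R\alpha$ is continuous. The reduced saltus set $\{(x_i,a_i)\}$ of $S_L\alpha$ consists of the pairs $(t,\alpha(t+)-\alpha(t))$ with $\alpha(t+)-\alpha(t)\ne0$; the reduced saltus set $\{(y_i,b_i)\}$ of $S_R\alpha$ consists of the pairs $(t,\alpha(t)-\alpha(t-))$ with $\alpha(t)-\alpha(t-)\neq0$. These sets may be finite or empty, in which case the sums are finite or empty. *)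

theory Defs
  imports "HOL-Analysis.Analysis"
begin

text \<open>
  Functions on \<open>[a, b]\<close> are total functions of type \<open>real \<Rightarrow> real\<close> whose values outside \<open>{a..b}\<close>
  play no role. In particular, the one-sided limits below respect the conventions
  \<open>g (b+) = g b\<close> and \<open>g (a-) = g a\<close>.
\<close>

definition rlim :: "real \<Rightarrow> (real \<Rightarrow> real) \<Rightarrow> real \<Rightarrow> real" where
  "rlim b g x = (if x = b then g b else Lim (at_right x) g)"

definition llim :: "real \<Rightarrow> (real \<Rightarrow> real) \<Rightarrow> real \<Rightarrow> real" where
  "llim a g x = (if x = a then g a else Lim (at_left x) g)"

definition mu_open :: "real \<Rightarrow> real \<Rightarrow> (real \<Rightarrow> real) \<Rightarrow> real \<Rightarrow> real \<Rightarrow> real" where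
  "mu_open a b \<alpha> c d = llim a \<alpha> d - rlim b \<alpha> c"

definition mu_point :: "real \<Rightarrow> real \<Rightarrow> (real \<Rightarrow> real) \<Rightarrow> real \<Rightarrow> real" where
  "mu_point a b \<alpha> c = rlim b \<alpha> c - llim a \<alpha> c"

definition is_partition :: "real \<Rightarrow> real \<Rightarrow> nat \<Rightarrow> (nat \<Rightarrow> real) \<Rightarrow> bool" where
  "is_partition a b n x \<longleftrightarrow> x 0 = a \<and> x n = b \<and> (\<forall>i<n. x i < x (Suc i))"

definition is_step_with ::
    "real \<Rightarrow> real \<Rightarrow> (real \<Rightarrow> real) \<Rightarrow> nat \<Rightarrow> (nat \<Rightarrow> real) \<Rightarrow> (nat \<Rightarrow> real) \<Rightarrow> bool" where
  "is_step_with a b u n x c \<longleftrightarrow>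
     is_partition a b n x \<and> (\<forall>i\<in>{1..n}. \<forall>t\<in>{x (i - 1)<..<x i}. u t = c i)"

text \<open>
  The integrals of a step function do not depend on the representing partition; they are given
  as relations, so that no choice of a partition is needed. Both relations entail that \<open>u\<close> is a
  step function on \<open>[a, b]\<close> (and hence bounded there).
\<close>

definition has_RDS_step_integral ::
    "real \<Rightarrow> real \<Rightarrow> (real \<Rightarrow> real) \<Rightarrow> (real \<Rightarrow> real) \<Rightarrow> real \<Rightarrow> bool" where
  "has_RDS_step_integral a b \<alpha> u I \<longleftrightarrow>
     (\<exists>n x c. is_step_with a b u n x c \<and>
        I = (\<Sum>i=0..n. u (x i) * mu_point a b \<alpha> (x i))
          + (\<Sum>i=1..n. c i * mu_open a b \<alpha> (x (i - 1)) (x i)))"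

definition has_DS_step_integral ::
    "real \<Rightarrow> real \<Rightarrow> (real \<Rightarrow> real) \<Rightarrow> (real \<Rightarrow> real) \<Rightarrow> real \<Rightarrow> bool" where
  "has_DS_step_integral a b \<alpha> u I \<longleftrightarrow>
     (\<exists>n x c. is_step_with a b u n x c \<and> I = (\<Sum>i=1..n. c i * (\<alpha> (x i) - \<alpha> (x (i - 1)))))"

text \<open>
  The real \<open>Sup\<close> and \<open>Inf\<close> below are genuine: for \<open>f\<close> bounded and \<open>\<alpha>\<close> nondecreasing on \<open>[a, b]\<close>,
  the sets are nonempty and bounded above and below, respectively.
\<close>

definition RDS_lower :: "real \<Rightarrow> real \<Rightarrow> (real \<Rightarrow> real) \<Rightarrow> (real \<Rightarrow> real) \<Rightarrow> real" where
  "RDS_lower a b \<alpha> f =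
     Sup {I. \<exists>v. (\<forall>t\<in>{a..b}. v t \<le> f t) \<and> has_RDS_step_integral a b \<alpha> v I}"

definition RDS_upper :: "real \<Rightarrow> real \<Rightarrow> (real \<Rightarrow> real) \<Rightarrow> (real \<Rightarrow> real) \<Rightarrow> real" where
  "RDS_upper a b \<alpha> f =
     Inf {I. \<exists>u. (\<forall>t\<in>{a..b}. f t \<le> u t) \<and> has_RDS_step_integral a b \<alpha> u I}"

definition DS_lower :: "real \<Rightarrow> real \<Rightarrow> (real \<Rightarrow> real) \<Rightarrow> (real \<Rightarrow> real) \<Rightarrow> real" where
  "DS_lower a b \<alpha> f =
     Sup {I. \<exists>v. (\<forall>t\<in>{a..b}. v t \<le> f t) \<and> has_DS_step_integral a b \<alpha> v I}"

definition DS_upper :: "real \<Rightarrow> real \<Rightarrow> (real \<Rightarrow> real) \<Rightarrow> (real \<Rightarrow> real) \<Rightarrow> real" where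
  "DS_upper a b \<alpha> f =
     Inf {I. \<exists>u. (\<forall>t\<in>{a..b}. f t \<le> u t) \<and> has_DS_step_integral a b \<alpha> u I}"

definition RDS :: "real \<Rightarrow> real \<Rightarrow> (real \<Rightarrow> real) \<Rightarrow> (real \<Rightarrow> real) set" where
  "RDS a b \<alpha> = {f. bounded (f ` {a..b}) \<and> RDS_lower a b \<alpha> f = RDS_upper a b \<alpha> f}"

definition DS :: "real \<Rightarrow> real \<Rightarrow> (real \<Rightarrow> real) \<Rightarrow> (real \<Rightarrow> real) set" where
  "DS a b \<alpha> = {f. bounded (f ` {a..b}) \<and> DS_lower a b \<alpha> f = DS_upper a b \<alpha> f}"

text \<open>The common values; meaningful for members of \<open>RDS a b \<alpha>\<close> and \<open>DS a b \<alpha>\<close>.\<close>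

definition RDS_integral :: "real \<Rightarrow> real \<Rightarrow> (real \<Rightarrow> real) \<Rightarrow> (real \<Rightarrow> real) \<Rightarrow> real" where
  "RDS_integral a b \<alpha> f = RDS_lower a b \<alpha> f"

definition DS_integral :: "real \<Rightarrow> real \<Rightarrow> (real \<Rightarrow> real) \<Rightarrow> (real \<Rightarrow> real) \<Rightarrow> real" where
  "DS_integral a b \<alpha> f = DS_lower a b \<alpha> f"

text \<open>
  The reduced saltus sets of the two saltus parts
  \<open>S\<^sub>L \<alpha> x = (\<Sum>t. (\<alpha> (t+) - \<alpha> t) * H\<^sub>0 (x - t))\<close> and
  \<open>S\<^sub>R \<alpha> x = (\<Sum>t. (\<alpha> t - \<alpha> (t-)) * H\<^sub>1 (x - t))\<close> in \<open>\<alpha> = G \<alpha> + S\<^sub>L \<alpha> + S\<^sub>R \<alpha>\<close>: the points of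
  \<open>[a, b]\<close> at which \<open>\<alpha>\<close> jumps on the right (respectively on the left), paired with the jumps.
  By the endpoint conventions the points lie in \<open>[a, b)\<close> and \<open>(a, b]\<close>, respectively.
\<close>

definition saltus_set_L :: "real \<Rightarrow> real \<Rightarrow> (real \<Rightarrow> real) \<Rightarrow> (real \<times> real) set" where
  "saltus_set_L a b \<alpha> = {(t, rlim b \<alpha> t - \<alpha> t) | t. t \<in> {a..b} \<and> rlim b \<alpha> t - \<alpha> t \<noteq> 0}"

definition saltus_set_R :: "real \<Rightarrow> real \<Rightarrow> (real \<Rightarrow> real) \<Rightarrow> (real \<times> real) set" where
  "saltus_set_R a b \<alpha> = {(t, \<alpha> t - llim a \<alpha> t) | t. t \<in> {a..b} \<and> \<alpha> t - llim a \<alpha> t \<noteq> 0}"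

end

theory Submission
  imports Defs
begin

text \<open>
  For a finite set \<open>Q\<close> of points of \<open>[a, b]\<close> let \<open>u\<^sub>Q\<close> agree with \<open>f\<close> on \<open>Q\<close> and be the supremum of
  \<open>f\<close> on each component of \<open>[a, b] - Q\<close>. Along the directed set of all such \<open>Q\<close>, both the DS and
  the RDS integrals of \<open>u\<^sub>Q\<close> tend to the respective upper integrals of \<open>f\<close>. The two integrals of
  \<open>u\<^sub>Q\<close> differ by the finite sum over \<open>t \<in> Q\<close> of
  \<open>(\<alpha> (t+) - \<alpha> t) * (u\<^sub>Q (t+) - f t) + (\<alpha> t - \<alpha> (t-)) * (u\<^sub>Q (t-) - f t)\<close>, and \<open>u\<^sub>Q (t+)\<close>,
  \<open>u\<^sub>Q (t-)\<close> decrease to the one-sided upper limits of \<open>f\<close>. By dominated convergence the upper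
  DS integral is the upper RDS integral plus the infinite sum \<open>s f\<close> of the limiting terms; applied
  to \<open>- f\<close>, this says that the lower DS integral is the lower RDS integral minus \<open>s (- f)\<close>. Since
  \<open>s f + s (- f) \<ge> 0\<close>, with equality exactly if \<open>f\<close> has the required one-sided limits, all
  four integrals agree if and only if \<open>f\<close> is RDS integrable, the limits exist and \<open>s f = 0\<close>.
\<close>

subsection \<open>Partitions and step functions\<close>

lemma sum_from_1: "(\<Sum>i=1..n. g i) = (\<Sum>i<n. g (Suc i))"
  by (simp add: sum.atLeast1_atMost_eq)

lemma partition_less:
  assumes "is_partition a b n x" "i < j" "j \<le> n"
  shows "x i < x j"
  using assms(2,3)
proof (induction j)
  case (Suc j)
  have "x j < x (Suc j)" using assms(1) Suc.prems by (simp add: is_partition_def)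
  moreover have "x i < x j" if "i \<noteq> j" using Suc that by simp
  ultimately show ?case by (cases "i = j") simp_all
qed simp

lemma partition_le:
  assumes "is_partition a b n x" "i \<le> j" "j \<le> n"
  shows "x i \<le> x j"
  using partition_less[OF assms(1), of i j] assms(2,3) by (cases "i = j") simp_all

lemma partition_bounds:
  assumes "is_partition a b n x" "i \<le> n"
  shows "a \<le> x i" "x i \<le> b"
  using partition_le[OF assms(1), of 0 i] partition_le[OF assms(1), of i n] assms
  by (auto simp: is_partition_def)

lemma partition_inj:
  assumes "is_partition a b n x"
  shows "inj_on x {0..n}"
  by (rule linorder_inj_onI) (use partition_less[OF assms] in force)+

lemma partition_cover:
  assumes P: "is_partition a b n x" and t: "t \<in> {a..b}" "t \<notin> x ` {0..n}"
  obtains i where "i < n" "x i < t" "t < x (Suc i)"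
proof -
  define i where "i = Max {i. i \<le> n \<and> x i < t}"
  have "x 0 < t" using t P by (force simp: is_partition_def)
  then have ne: "{i. i \<le> n \<and> x i < t} \<noteq> {}" by blast
  have i: "i \<le> n" "x i < t" using Max_in[OF _ ne] by (auto simp: i_def)
  have "i \<noteq> n" using i t P by (auto simp: is_partition_def)
  with i have "i < n" by simp
  have "\<not> x (Suc i) < t"
  proof
    assume "x (Suc i) < t"
    with \<open>i < n\<close> have "Suc i \<le> i" unfolding i_def by (intro Max_ge) auto
    then show False by simp
  qed
  moreover have "x (Suc i) \<noteq> t" using t \<open>i < n\<close> by auto
  ultimately show thesis using that i \<open>i < n\<close> by force
qed

text \<open>Sorting a finite set lists its points as a partition, so partitions may be handled as
  finite sets ordered by inclusion, where a common refinement is a union.\<close>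

lemma ex_partition:
  fixes a b :: real
  assumes "finite Q" "{a, b} \<subseteq> Q" "Q \<subseteq> {a..b}"
  obtains n x where "is_partition a b n x" "x ` {0..n} = Q"
proof -
  define xs where "xs = sorted_list_of_set Q"
  have xs: "set xs = Q" "sorted_wrt (<) xs" using assms(1) by (auto simp: xs_def)
  then have ne: "xs \<noteq> []" using assms by auto
  define n where "n = length xs - 1"
  have len: "length xs = Suc n" using ne by (simp add: n_def)
  have mono: "xs ! i < xs ! j" if "i < j" "j \<le> n" for i j
    using xs(2) that len by (simp add: sorted_wrt_iff_nth_less)
  have img: "(!) xs ` {0..n} = Q"
    using xs(1) len by (auto simp: set_conv_nth image_iff less_Suc_eq_le)
  have ge: "a \<le> xs ! i" "xs ! i \<le> b" if "i \<le> n" for i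
    using img assms(3) that by fastforce+
  obtain i j where ij: "i \<le> n" "xs ! i = a" "j \<le> n" "xs ! j = b"
    using img assms(2) by (auto simp: image_iff)
  have "xs ! 0 = a" using mono[of 0 i] ge(1)[of 0] ij by (cases "i = 0") auto
  moreover have "xs ! n = b" using mono[of j n] ge(2)[of n] ij by (cases "j = n") auto
  ultimately have "is_partition a b n ((!) xs)"
    unfolding is_partition_def using mono[OF lessI] by (simp add: Suc_le_eq)
  with img that show thesis by blast
qed

text \<open>Encoded by the side of each point of \<open>Q\<close> on which \<open>s\<close> lies:
  for \<open>t\<close> in \<open>{a..b}\<close> outside \<open>Q\<close> this is the connected
  component of \<open>t\<close> in \<open>{a..b} - Q\<close>, and for \<open>t\<close> in
  \<open>Q\<close> it is empty. Comparing with all of \<open>Q\<close> rather than with the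
  neighbours of \<open>t\<close> makes antitonicity in \<open>Q\<close> immediate.\<close>

definition component :: "real \<Rightarrow> real \<Rightarrow> real set \<Rightarrow> real \<Rightarrow> real set" where
  "component a b Q t = {s \<in> {a..b}. \<forall>r\<in>Q. (r < s \<and> r < t) \<or> (s < r \<and> t < r)}"

text \<open>Values on \<open>Q\<close> are unconstrained because the components of its points are
  empty. Unlike the indexed representation, this property passes at once to supersets of
  \<open>Q\<close>.\<close>

definition step_on :: "real \<Rightarrow> real \<Rightarrow> real set \<Rightarrow> (real \<Rightarrow> real) \<Rightarrow> bool" where
  "step_on a b Q u \<longleftrightarrow> (\<forall>t\<in>{a..b}. \<forall>s\<in>component a b Q t. u s = u t)"

lemma component_self: "t \<in> {a..b} \<Longrightarrow> t \<notin> Q \<Longrightarrow> t \<in> component a b Q t"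
  by (simp add: component_def) (metis linorder_less_linear)

lemma component_mem: "t \<in> Q \<Longrightarrow> component a b Q t = {}"
  by (auto simp: component_def)

lemma component_mono: "P \<subseteq> Q \<Longrightarrow> component a b Q t \<subseteq> component a b P t"
  by (auto simp: component_def)

lemma component_subset: "component a b Q t \<subseteq> {a..b}"
  by (auto simp: component_def)

lemma component_eq:
  assumes "s \<in> component a b Q t"
  shows "component a b Q s = component a b Q t"
proof -
  have *: "r < s \<and> r < t \<or> s < r \<and> t < r" if "r \<in> Q" for r
    using assms that by (simp add: component_def)
  have "r < p \<and> r < s \<or> p < r \<and> s < r \<longleftrightarrow> r < p \<and> r < t \<or> p < r \<and> t < r" if "r \<in> Q" for r p
    using *[OF that] by linarith
  then show ?thesis unfolding component_def by (intro Collect_cong conj_cong ball_cong refl)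
qed

lemma component_interval:
  assumes "x \<in> Q" "y \<in> Q" "x < t" "t < y"
  shows "component a b Q t \<subseteq> {x<..<y}"
  using assms by (fastforce simp: component_def)

lemma step_on_mono: "step_on a b P u \<Longrightarrow> P \<subseteq> Q \<Longrightarrow> step_on a b Q u"
  unfolding step_on_def using component_mono by blast

lemma is_step_with_step_on:
  assumes "is_step_with a b u n x c"
  shows "step_on a b (x ` {0..n}) u"
  unfolding step_on_def
proof (intro ballI)
  fix t s assume t: "t \<in> {a..b}" and s: "s \<in> component a b (x ` {0..n}) t"
  have "t \<notin> x ` {0..n}" using s component_mem by blast
  then obtain i where i: "i < n" "x i < t" "t < x (Suc i)"
    using partition_cover[of a b n x t] t assms by (auto simp: is_step_with_def)
  then have "s \<in> {x i<..<x (Suc i)}"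
    using s component_interval[of "x i" "x ` {0..n}" "x (Suc i)" t a b] by auto
  moreover have "\<forall>t\<in>{x i<..<x (Suc i)}. u t = c (Suc i)"
    using assms i(1) unfolding is_step_with_def by (metis One_nat_def Suc_leI atLeastAtMost_iff
      diff_Suc_Suc diff_zero le_add1 plus_1_eq_Suc)
  ultimately show "u s = u t" using i by auto
qed

lemma partition_gap:
  assumes P: "is_partition a b n x" and "i < n" "j \<le> n" "x i < x j"
  shows "x (Suc i) \<le> x j"
proof -
  have "\<not> j \<le> i" using partition_le[OF P, of j i] assms by auto
  then show ?thesis using partition_le[OF P, of "Suc i" j] assms by auto
qed

text \<open>Each open interval of the partition lies in one component, so the value at its midpoint
  can serve as the constant.\<close>

lemma step_on_is_step_with:
  assumes P: "is_partition a b n x" and u: "step_on a b (x ` {0..n}) u"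
  shows "is_step_with a b u n x (\<lambda>i. u ((x (i - 1) + x i) / 2))"
  unfolding is_step_with_def
proof (intro conjI P ballI)
  fix i t assume "i \<in> {1..n}" and t: "t \<in> {x (i - 1)<..<x i}"
  then obtain j where j: "i = Suc j" "j < n" by (cases i) auto
  let ?m = "(x (i - 1) + x i) / 2"
  have lt: "x j < x (Suc j)" using partition_less[OF P, of j "Suc j"] j by simp
  have b: "a \<le> x j" "x (Suc j) \<le> b" using partition_bounds[OF P] j by auto
  have "(r < t \<and> r < ?m) \<or> (t < r \<and> ?m < r)" if "r \<in> x ` {0..n}" for r
  proof (cases "r \<le> x j")
    case True
    with t j lt show ?thesis by simp
  next
    case False
    with that have "x (Suc j) \<le> r" using partition_gap[OF P j(2)] by auto
    with t j lt show ?thesis by simp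
  qed
  then have "t \<in> component a b (x ` {0..n}) ?m"
    using t j b by (auto simp: component_def)
  moreover have "?m \<in> {a..b}" using b lt j by auto
  ultimately show "u t = u ?m" using u unfolding step_on_def by blast
qed

text \<open>Instead of forming a common refinement, the integral over \<open>[a, s]\<close> is built
  from the first representation as a function \<open>\<Phi>\<close> of \<open>s\<close>. Its
  increments over the intervals of the second representation are the terms of the second sum, which
  therefore telescopes to \<open>\<Phi> b - \<Phi> a\<close>.\<close>

lemma DS_step_sum_unique:
  assumes S: "is_step_with a b u n x c" and S': "is_step_with a b u m y d"
  shows "(\<Sum>i=1..n. c i * (\<alpha> (x i) - \<alpha> (x (i - 1)))) = (\<Sum>i=1..m. d i * (\<alpha> (y i) - \<alpha> (y (i - 1))))"
    (is "?I = ?J")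
proof -
  have P: "is_partition a b n x" and P': "is_partition a b m y"
    using S S' by (auto simp: is_step_with_def)
  have xn: "x 0 = a" "x n = b" "y 0 = a" "y m = b" using P P' by (auto simp: is_partition_def)
  have x: "x i < x (Suc i)" if "i < n" for i using P that by (auto simp: is_partition_def)
  have y: "y i < y (Suc i)" if "i < m" for i using P' that by (auto simp: is_partition_def)
  have uc: "u t = c (Suc i)" if "i < n" "x i < t" "t < x (Suc i)" for i t
    using S that by (auto simp: is_step_with_def dest!: bspec[of "{1..n}" _ "Suc i"])
  have ud: "u t = d (Suc i)" if "i < m" "y i < t" "t < y (Suc i)" for i t
    using S' that by (auto simp: is_step_with_def dest!: bspec[of "{1..m}" _ "Suc i"])
  \<comment> \<open>\<open>k i s\<close> is \<open>s\<close> clamped to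
    \<open>[x i, x (Suc i)]\<close>, so the \<open>i\<close>-th term of \<open>\<Phi> s\<close> is
    what this interval contributes up to \<open>s\<close>.\<close>
  define k where "k i s = max (x i) (min s (x (Suc i)))" for i s
  define \<Phi> where "\<Phi> s = (\<Sum>i<n. c (Suc i) * (\<alpha> (k i s) - \<alpha> (x i)))" for s
  have tele: "(\<Sum>i<j. \<alpha> (k i t) - \<alpha> (x i)) = \<alpha> (min t (x j)) - \<alpha> a"
    if "j \<le> n" "a \<le> t" for j t
    using that(1)
  proof (induction j)
    case 0
    then show ?case using xn that by (simp add: min_def)
  next
    case (Suc j)
    then show ?case using x[of j] by (auto simp: k_def min_def max_def)
  qed
  have \<Phi>: "\<Phi> t - \<Phi> s = e * (\<alpha> t - \<alpha> s)"
    if st: "a \<le> s" "s < t" "t \<le> b" and e: "\<And>r. s < r \<Longrightarrow> r < t \<Longrightarrow> u r = e" for s t e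
  proof -
    \<comment> \<open>A degenerate clamped interval gives 0 on both sides; otherwise its midpoint
      \<open>r\<close> lies both in \<open>(s, t)\<close> and in \<open>(x i, x (Suc i))\<close>,
      whence \<open>c (Suc i) = u r = e\<close>.\<close>
    have "c (Suc i) * (\<alpha> (k i t) - \<alpha> (k i s)) = e * (\<alpha> (k i t) - \<alpha> (k i s))" if i: "i < n" for i
    proof (cases "k i s < k i t")
      case True
      define r where "r = (k i s + k i t) / 2"
      have "x i < r" "r < x (Suc i)" "s < r" "r < t"
        using True x[OF i] st by (auto simp: r_def k_def min_def max_def split: if_splits)
      then show ?thesis using uc[OF i] e by metis
    next
      case False
      then have "k i s = k i t" using st by (auto simp: k_def min_def max_def split: if_splits)
      then show ?thesis by simp
    qed
    then have "(\<Sum>i<n. c (Suc i) * (\<alpha> (k i t) - \<alpha> (k i s)))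
        = (\<Sum>i<n. e * (\<alpha> (k i t) - \<alpha> (k i s)))"
      by (intro sum.cong) auto
    then have "\<Phi> t - \<Phi> s = e * ((\<Sum>i<n. \<alpha> (k i t) - \<alpha> (x i)) - (\<Sum>i<n. \<alpha> (k i s) - \<alpha> (x i)))"
      by (simp add: \<Phi>_def sum_subtractf[symmetric] sum_distrib_left right_diff_distrib[symmetric]
          del: mult_cancel_left)
    also have "\<dots> = e * (\<alpha> t - \<alpha> s)"
      using st xn by (simp add: tele)
    finally show ?thesis .
  qed
  have "?J = (\<Sum>i<m. \<Phi> (y (Suc i)) - \<Phi> (y i))"
    unfolding sum_from_1
  proof (rule sum.cong)
    fix i assume "i \<in> {..<m}"
    then have i: "i < m" by simp
    show "d (Suc i) * (\<alpha> (y (Suc i)) - \<alpha> (y (Suc i - 1))) = \<Phi> (y (Suc i)) - \<Phi> (y i)"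
      using \<Phi>[OF partition_bounds(1)[OF P'] y[OF i] partition_bounds(2)[OF P'] ud[OF i]] i by simp
  qed simp
  also have "\<dots> = \<Phi> b - \<Phi> a"
    using sum_lessThan_telescope[of "\<lambda>i. \<Phi> (y i)" m] xn by simp
  also have "\<Phi> a = 0"
    unfolding \<Phi>_def
  proof (intro sum.neutral ballI)
    fix i assume "i \<in> {..<n}"
    then have "k i a = x i"
      using x[of i] partition_bounds(1)[OF P, of i] by (simp add: k_def)
    then show "c (Suc i) * (\<alpha> (k i a) - \<alpha> (x i)) = 0" by simp
  qed
  also have "\<Phi> b = ?I"
    unfolding \<Phi>_def sum_from_1
  proof (rule sum.cong)
    fix i assume "i \<in> {..<n}"
    then have "k i b = x (Suc i)"
      using x[of i] partition_bounds[OF P, of "Suc i"] by (simp add: k_def)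
    then show "c (Suc i) * (\<alpha> (k i b) - \<alpha> (x i)) = c (Suc i) * (\<alpha> (x (Suc i)) - \<alpha> (x (Suc i - 1)))"
      by simp
  qed simp
  finally show ?thesis by simp
qed

subsection \<open>Jumps of a nondecreasing integrator\<close>

lemma sum_split_last: "(\<Sum>i=0..n. g i) = (\<Sum>i<n. g i) + g n"
  for g :: "nat \<Rightarrow> real"
  by (induction n) simp_all

lemma sum_split_first: "(\<Sum>i=0..n. g i) = g 0 + (\<Sum>i<n. g (Suc i))"
  for g :: "nat \<Rightarrow> real"
  by (induction n) simp_all

section \<open>One-sided limits of step functions and of monotone functions\<close>

lemma Lim_eventually_const:
  fixes c :: real
  assumes "eventually (\<lambda>s. u s = c) F" "F \<noteq> bot"
  shows "Lim F u = c"
  using tendsto_Lim[OF assms(2) tendsto_eventually[OF assms(1)]] .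

text \<open>A finite \<open>Q\<close> leaves a gap \<open>(t, d)\<close> free of its points, and
  this gap lies in a single component; if \<open>t\<close> is not in \<open>Q\<close>, that
  component contains \<open>t\<close> as well, which gives the second claim.\<close>

lemma step_on_right:
  fixes u :: "real \<Rightarrow> real"
  assumes "finite Q" "step_on a b Q u" "a \<le> t" "t < b"
  shows "eventually (\<lambda>s. u s = rlim b u t) (at_right t)"
    and "t \<notin> Q \<Longrightarrow> rlim b u t = u t"
proof -
  \<comment> \<open>Removing \<open>t\<close> from \<open>Q\<close> lets one neighbourhood serve
    both cases, \<open>t\<close> in \<open>Q\<close> or not.\<close>
  have "open (- (Q - {t}))" using assms(1) by (intro open_Compl finite_imp_closed) auto
  then have "eventually (\<lambda>s. s \<in> - (Q - {t})) (nhds t)" by (intro eventually_nhds_in_open) auto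
  then obtain e where e: "e > 0" "\<And>s. dist s t < e \<Longrightarrow> s \<notin> Q - {t}"
    by (auto simp: eventually_nhds_metric)
  define d where "d = min b (t + e)"
  have d: "t < d" "d \<le> b" using e assms by (auto simp: d_def)
  have gap: "s \<notin> Q" if "t < s" "s < d" for s
    using e(2)[of s] that by (auto simp: d_def dist_real_def)
  have eq: "u s = u r" if s: "s \<in> {t..<d}" "r \<in> {t..<d}" and "t \<in> Q \<longrightarrow> s \<noteq> t \<and> r \<noteq> t" for r s
  proof -
    have "p < s \<and> p < r \<or> s < p \<and> r < p" if "p \<in> Q" for p
    proof -
      have "p \<le> t \<or> d \<le> p" using gap[of p] that by force
      then show ?thesis using that s \<open>t \<in> Q \<longrightarrow> _\<close> by (cases "p = t") auto
    qed
    then have "s \<in> component a b Q r" using s d assms by (auto simp: component_def)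
    then show ?thesis using assms(2) s d assms(3) unfolding step_on_def
      by (meson atLeastAtMost_iff atLeastLessThan_iff less_imp_le order.trans)
  qed
  define m where "m = (t + d) / 2"
  have m: "t < m" "m < d" using d by (auto simp: m_def)
  have "u s = u m" if "t < s" "s < d" for s
    using that d m by (intro eq) auto
  then have ev: "eventually (\<lambda>s. u s = u m) (at_right t)"
    using d by (auto simp: eventually_at_right[OF d(1)])
  then have rl: "rlim b u t = u m" using assms(4) by (auto simp: rlim_def intro!: Lim_eventually_const)
  with ev show "eventually (\<lambda>s. u s = rlim b u t) (at_right t)" by simp
  show "rlim b u t = u t" if "t \<notin> Q" using rl eq[of m t] m d that by simp
qed

lemma step_on_left:
  fixes u :: "real \<Rightarrow> real"
  assumes "finite Q" "step_on a b Q u" "a < t" "t \<le> b"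
  shows "eventually (\<lambda>s. u s = llim a u t) (at_left t)"
    and "t \<notin> Q \<Longrightarrow> llim a u t = u t"
proof -
  have "open (- (Q - {t}))" using assms(1) by (intro open_Compl finite_imp_closed) auto
  then have "eventually (\<lambda>s. s \<in> - (Q - {t})) (nhds t)" by (intro eventually_nhds_in_open) auto
  then obtain e where e: "e > 0" "\<And>s. dist s t < e \<Longrightarrow> s \<notin> Q - {t}"
    by (auto simp: eventually_nhds_metric)
  define d where "d = max a (t - e)"
  have d: "d < t" "a \<le> d" using e assms by (auto simp: d_def)
  have gap: "s \<notin> Q" if "d < s" "s < t" for s
    using e(2)[of s] that by (auto simp: d_def dist_real_def)
  have eq: "u s = u r" if s: "s \<in> {d<..t}" "r \<in> {d<..t}" and "t \<in> Q \<longrightarrow> s \<noteq> t \<and> r \<noteq> t" for r s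
  proof -
    have "p < s \<and> p < r \<or> s < p \<and> r < p" if "p \<in> Q" for p
    proof -
      have "p \<le> d \<or> t \<le> p" using gap[of p] that by force
      then show ?thesis using that s \<open>t \<in> Q \<longrightarrow> _\<close> by (cases "p = t") auto
    qed
    then have "s \<in> component a b Q r" using s d assms by (auto simp: component_def)
    then show ?thesis using assms(2) s d assms(4) unfolding step_on_def
      by (meson atLeastAtMost_iff greaterThanAtMost_iff less_imp_le order.trans)
  qed
  define m where "m = (t + d) / 2"
  have m: "d < m" "m < t" using d by (auto simp: m_def)
  have "u s = u m" if "d < s" "s < t" for s
    using that d m by (intro eq) auto
  then have ev: "eventually (\<lambda>s. u s = u m) (at_left t)"
    using d by (auto simp: eventually_at_left[OF d(1)])
  then have rl: "llim a u t = u m" using assms(3) by (auto simp: llim_def intro!: Lim_eventually_const)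
  with ev show "eventually (\<lambda>s. u s = llim a u t) (at_left t)" by simp
  show "llim a u t = u t" if "t \<notin> Q" using rl eq[of m t] m d that by simp
qed

text \<open>\<open>rlim\<close> rests on \<open>Lim\<close>, an unspecified value when no limit
  exists. By monotonicity the infimum of the values on \<open>(t, b]\<close> is the limit, so here
  \<open>rlim\<close> is genuine.\<close>

lemma mono_on_tendsto_rlim:
  fixes g :: "real \<Rightarrow> real"
  assumes mono: "mono_on {a..b} g" and t: "a \<le> t" "t < b"
  shows "(g \<longlongrightarrow> rlim b g t) (at_right t)"
proof -
  have bdd: "bdd_below (g ` {t<..b})"
    by (rule bdd_belowI2[of _ "g t"]) (use mono_onD[OF mono, of t] t in auto)
  have "(g \<longlongrightarrow> Inf (g ` {t<..b})) (at_right t)"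
  proof (rule decreasing_tendsto)
    show "eventually (\<lambda>s. Inf (g ` {t<..b}) \<le> g s) (at_right t)"
      using t bdd by (auto simp: eventually_at_right[of t b] intro!: exI[of _ b] cINF_lower)
    fix x assume "Inf (g ` {t<..b}) < x"
    then obtain s where "s \<in> {t<..b}" "g s < x" using t bdd by (subst (asm) cINF_less_iff) auto
    moreover have "g y \<le> g s" if "t < y" "y < s" for y
      using that \<open>s \<in> {t<..b}\<close> t by (intro mono_onD[OF mono]) auto
    ultimately show "eventually (\<lambda>s. g s < x) (at_right t)"
      using t by (fastforce simp: eventually_at_right[of t b])
  qed
  moreover from this have "Lim (at_right t) g = Inf (g ` {t<..b})"
    by (intro tendsto_Lim) (auto simp: trivial_limit_at_right_real)
  ultimately show ?thesis using t by (simp add: rlim_def)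
qed

lemma mono_on_tendsto_llim:
  fixes g :: "real \<Rightarrow> real"
  assumes mono: "mono_on {a..b} g" and t: "a < t" "t \<le> b"
  shows "(g \<longlongrightarrow> llim a g t) (at_left t)"
proof -
  have bdd: "bdd_above (g ` {a..<t})"
    by (rule bdd_aboveI2[of _ _ "g t"]) (use mono_onD[OF mono, of _ t] t in auto)
  have "(g \<longlongrightarrow> Sup (g ` {a..<t})) (at_left t)"
  proof (rule increasing_tendsto)
    show "eventually (\<lambda>s. g s \<le> Sup (g ` {a..<t})) (at_left t)"
      using t bdd by (auto simp: eventually_at_left[of a t] intro!: exI[of _ a] cSUP_upper)
    fix x assume "x < Sup (g ` {a..<t})"
    then obtain s where "s \<in> {a..<t}" "x < g s" using t bdd by (subst (asm) less_cSUP_iff) auto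
    moreover have "g s \<le> g y" if "s < y" "y < t" for y
      using that \<open>s \<in> {a..<t}\<close> t by (intro mono_onD[OF mono]) auto
    ultimately show "eventually (\<lambda>s. x < g s) (at_left t)"
      using t by (fastforce simp: eventually_at_left[of a t])
  qed
  moreover from this have "Lim (at_left t) g = Sup (g ` {a..<t})"
    by (intro tendsto_Lim) (auto simp: trivial_limit_at_left_real)
  ultimately show ?thesis using t by (simp add: llim_def)
qed

section \<open>Jump masses and the difference between the two step sums\<close>

locale stieltjes =
  fixes a b :: real and \<alpha> :: "real \<Rightarrow> real"
  assumes ab: "a < b" and mono: "mono_on {a..b} \<alpha>"
begin

definition jump_r :: "real \<Rightarrow> real" where "jump_r t = rlim b \<alpha> t - \<alpha> t"
definition jump_l :: "real \<Rightarrow> real" where "jump_l t = \<alpha> t - llim a \<alpha> t"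

text \<open>The DS sum weights the jumps at \<open>t\<close> with the one-sided values of
  \<open>u\<close> next to \<open>t\<close>, the RDS sum with \<open>u t\<close> itself; this is the
  resulting discrepancy at \<open>t\<close>.\<close>

definition saltus_gap :: "(real \<Rightarrow> real) \<Rightarrow> real \<Rightarrow> real" where
  "saltus_gap u t = jump_r t * (rlim b u t - u t) + jump_l t * (llim a u t - u t)"

lemma jump_r_b [simp]: "jump_r b = 0" by (simp add: jump_r_def rlim_def)
lemma jump_l_a [simp]: "jump_l a = 0" by (simp add: jump_l_def llim_def)

lemma mu_point_eq: "mu_point a b \<alpha> t = jump_r t + jump_l t"
  by (simp add: mu_point_def jump_r_def jump_l_def)

lemma mu_open_eq: "mu_open a b \<alpha> c d = (\<alpha> d - \<alpha> c) - jump_l d - jump_r c"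
  by (simp add: mu_open_def jump_r_def jump_l_def)

lemma rlim_bounds:
  assumes "a \<le> t" "t < s" "s \<le> b"
  shows "\<alpha> t \<le> rlim b \<alpha> t" "rlim b \<alpha> t \<le> \<alpha> s"
proof -
  have lim: "(\<alpha> \<longlongrightarrow> rlim b \<alpha> t) (at_right t)"
    using assms by (intro mono_on_tendsto_rlim[OF mono]) auto
  have "\<alpha> t \<le> \<alpha> r \<and> \<alpha> r \<le> \<alpha> s" if "t < r" "r < s" for r
    using assms that by (auto intro!: mono_onD[OF mono])
  then have "eventually (\<lambda>r. \<alpha> t \<le> \<alpha> r \<and> \<alpha> r \<le> \<alpha> s) (at_right t)"
    using assms by (auto simp: eventually_at_right[of t s])
  then have "eventually (\<lambda>r. \<alpha> t \<le> \<alpha> r) (at_right t)" "eventually (\<lambda>r. \<alpha> r \<le> \<alpha> s) (at_right t)"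
    by (auto elim: eventually_mono)
  then show "\<alpha> t \<le> rlim b \<alpha> t" "rlim b \<alpha> t \<le> \<alpha> s"
    using tendsto_lowerbound[OF lim] tendsto_upperbound[OF lim]
    by (simp_all add: trivial_limit_at_right_real)
qed

lemma llim_bounds:
  assumes "a \<le> s" "s < t" "t \<le> b"
  shows "llim a \<alpha> t \<le> \<alpha> t" "\<alpha> s \<le> llim a \<alpha> t"
proof -
  have lim: "(\<alpha> \<longlongrightarrow> llim a \<alpha> t) (at_left t)"
    using assms by (intro mono_on_tendsto_llim[OF mono]) auto
  have "\<alpha> r \<le> \<alpha> t \<and> \<alpha> s \<le> \<alpha> r" if "s < r" "r < t" for r
    using assms that by (auto intro!: mono_onD[OF mono])
  then have "eventually (\<lambda>r. \<alpha> r \<le> \<alpha> t \<and> \<alpha> s \<le> \<alpha> r) (at_left t)"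
    using assms by (auto simp: eventually_at_left[of s t])
  then have "eventually (\<lambda>r. \<alpha> r \<le> \<alpha> t) (at_left t)" "eventually (\<lambda>r. \<alpha> s \<le> \<alpha> r) (at_left t)"
    by (auto elim: eventually_mono)
  then show "llim a \<alpha> t \<le> \<alpha> t" "\<alpha> s \<le> llim a \<alpha> t"
    using tendsto_lowerbound[OF lim] tendsto_upperbound[OF lim]
    by (simp_all add: trivial_limit_at_left_real)
qed

lemma jump_r_nonneg: "t \<in> {a..b} \<Longrightarrow> 0 \<le> jump_r t"
  using rlim_bounds(1)[of t b] by (cases "t = b") (auto simp: jump_r_def rlim_def)

lemma jump_l_nonneg: "t \<in> {a..b} \<Longrightarrow> 0 \<le> jump_l t"
  using llim_bounds(1)[of a t] by (cases "t = a") (auto simp: jump_l_def llim_def)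

text \<open>Both one-sided limits are compared with the value of \<open>\<alpha>\<close> at the
  midpoint.\<close>

lemma mu_open_nonneg:
  assumes "a \<le> c" "c < d" "d \<le> b"
  shows "0 \<le> mu_open a b \<alpha> c d"
  using rlim_bounds(2)[of c "(c + d) / 2"] llim_bounds(2)[of "(c + d) / 2" d] assms
  by (simp add: mu_open_def field_simps)

text \<open>Off \<open>Q\<close> both one-sided values of \<open>u\<close> are \<open>u t\<close>,
  and at an endpoint the outward jump is 0. Hence enlarging the point set never changes the sum of
  the gaps.\<close>

lemma saltus_gap_step_off:
  assumes "finite Q" "step_on a b Q u" "t \<in> {a..b} - Q"
  shows "saltus_gap u t = 0"
  using step_on_right(2)[OF assms(1,2), of t] step_on_left(2)[OF assms(1,2), of t] assms(3) ab
  by (cases "t = a"; cases "t = b") (auto simp: saltus_gap_def)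

text \<open>The mass of an open interval is the increment of \<open>\<alpha>\<close> minus the right
  jump at its left end and the left jump at its right end; collecting these jumps point by point
  yields the gaps.\<close>

lemma DS_minus_RDS_step_sum:
  assumes S: "is_step_with a b u n x c"
  shows "(\<Sum>i=1..n. c i * (\<alpha> (x i) - \<alpha> (x (i - 1))))
    = (\<Sum>i=0..n. u (x i) * mu_point a b \<alpha> (x i))
      + (\<Sum>i=1..n. c i * mu_open a b \<alpha> (x (i - 1)) (x i)) + sum (saltus_gap u) (x ` {0..n})"
proof -
  have P: "is_partition a b n x" using S by (simp add: is_step_with_def)
  have xn: "x 0 = a" "x n = b" using P by (auto simp: is_partition_def)
  have x: "x i < x (Suc i)" if "i < n" for i using P that by (auto simp: is_partition_def)
  have uc: "u t = c (Suc i)" if "i < n" "x i < t" "t < x (Suc i)" for i t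
    using S that by (auto simp: is_step_with_def dest!: bspec[of "{1..n}" _ "Suc i"])
  have r: "rlim b u (x i) = c (Suc i)" if "i < n" for i
  proof -
    have "eventually (\<lambda>t. u t = c (Suc i)) (at_right (x i))"
      using uc[OF that] x[OF that] by (auto simp: eventually_at_right[of "x i" "x (Suc i)"])
    moreover have "x i \<noteq> b" using partition_less[OF P, of i n] that xn by auto
    ultimately show ?thesis by (auto simp: rlim_def intro!: Lim_eventually_const)
  qed
  have l: "llim a u (x (Suc i)) = c (Suc i)" if "i < n" for i
  proof -
    have "eventually (\<lambda>t. u t = c (Suc i)) (at_left (x (Suc i)))"
      using uc[OF that] x[OF that] by (auto simp: eventually_at_left[of "x i" "x (Suc i)"])
    moreover have "x (Suc i) \<noteq> a" using partition_less[OF P, of 0 "Suc i"] that xn by auto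
    ultimately show ?thesis by (auto simp: llim_def intro!: Lim_eventually_const)
  qed
  \<comment> \<open>The term \<open>i = n\<close> drops out since \<open>jump_r b = 0\<close>, so
    each right jump is paired with the interval to its right; in the next sum the term
    \<open>i = 0\<close> drops out by \<open>jump_l a = 0\<close>.\<close>
  have "(\<Sum>i=0..n. jump_r (x i) * rlim b u (x i)) = (\<Sum>i<n. jump_r (x i) * c (Suc i))"
    using r by (simp add: sum_split_last xn)
  moreover have "(\<Sum>i=0..n. jump_l (x i) * llim a u (x i)) = (\<Sum>i<n. jump_l (x (Suc i)) * c (Suc i))"
    using l by (simp add: sum_split_first xn)
  moreover have "sum (saltus_gap u) (x ` {0..n})
    = (\<Sum>i=0..n. jump_r (x i) * rlim b u (x i)) + (\<Sum>i=0..n. jump_l (x i) * llim a u (x i))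
      - (\<Sum>i=0..n. u (x i) * mu_point a b \<alpha> (x i))"
    by (simp add: sum.reindex[OF partition_inj[OF P]] saltus_gap_def mu_point_eq
        sum.distrib[symmetric] sum_subtractf[symmetric] algebra_simps)
  moreover have "(\<Sum>i=1..n. c i * mu_open a b \<alpha> (x (i - 1)) (x i))
    = (\<Sum>i=1..n. c i * (\<alpha> (x i) - \<alpha> (x (i - 1)))) - (\<Sum>i<n. jump_l (x (Suc i)) * c (Suc i))
      - (\<Sum>i<n. jump_r (x i) * c (Suc i))"
    unfolding sum_from_1 mu_open_eq diff_Suc_1 sum_subtractf[symmetric]
    by (intro sum.cong) (simp_all add: algebra_simps)
  ultimately show ?thesis by linarith
qed

end

subsection \<open>Upper limits and dominated convergence\<close>

text \<open>The upper limit, kept real-valued: the infimum is meaningful when the eventual upper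
  bounds form a nonempty set bounded below, hence the eventual bounds on \<open>f\<close> in what
  follows.\<close>

definition real_limsup :: "'a filter \<Rightarrow> ('a \<Rightarrow> real) \<Rightarrow> real" where
  "real_limsup F f = Inf {c. eventually (\<lambda>t. f t \<le> c) F}"

lemma real_limsup_le:
  assumes "F \<noteq> bot" "eventually (\<lambda>t. - K \<le> f t) F" "eventually (\<lambda>t. f t \<le> c) F"
  shows "real_limsup F f \<le> c"
  unfolding real_limsup_def
proof (rule cInf_lower)
  show "bdd_below {c. eventually (\<lambda>t. f t \<le> c) F}"
  proof (rule bdd_belowI[of _ "- K"])
    fix d assume "d \<in> {c. eventually (\<lambda>t. f t \<le> c) F}"
    then have "eventually (\<lambda>t. f t \<le> d \<and> - K \<le> f t) F"
      using assms(2) by (auto intro: eventually_conj)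
    then show "- K \<le> d" using assms(1) eventually_happens' by fastforce
  qed
qed (use assms in simp)

lemma real_limsup_less:
  assumes "eventually (\<lambda>t. f t \<le> K) F" "real_limsup F f < c"
  shows "eventually (\<lambda>t. f t < c) F"
proof -
  have "{c. eventually (\<lambda>t. f t \<le> c) F} \<noteq> {}" using assms(1) by blast
  from cInf_lessD[OF this] assms(2) obtain d where d: "eventually (\<lambda>t. f t \<le> d) F" "d < c"
    by (auto simp: real_limsup_def)
  then show ?thesis by (auto elim: eventually_mono)
qed

text \<open>The negated second term is the lower limit of \<open>f\<close>, so the sum is the
  oscillation of \<open>f\<close> along \<open>F\<close>.\<close>

lemma real_limsup_uminus_ge:
  assumes F: "F \<noteq> bot" and K: "eventually (\<lambda>t. \<bar>f t\<bar> \<le> K) F"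
  shows "0 \<le> real_limsup F f + real_limsup F (\<lambda>t. - f t)"
proof (rule ccontr)
  \<comment> \<open>Half the deficit: if \<open>f\<close> and \<open>- f\<close> stay eventually
    below their upper limits plus \<open>e\<close>, adding the two inequalities gives
    \<open>0 < 0\<close>.\<close>
  define e where "e = - (real_limsup F f + real_limsup F (\<lambda>t. - f t)) / 2"
  assume "\<not> 0 \<le> real_limsup F f + real_limsup F (\<lambda>t. - f t)"
  then have "e > 0" by (simp add: e_def)
  then have "eventually (\<lambda>t. f t < real_limsup F f + e) F"
    using K by (intro real_limsup_less[of _ K]) (auto elim: eventually_mono)
  moreover have "eventually (\<lambda>t. - f t < real_limsup F (\<lambda>t. - f t) + e) F"
    using K \<open>e > 0\<close> by (intro real_limsup_less[of _ K]) (auto elim: eventually_mono)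
  ultimately have "eventually (\<lambda>t. False) F"
    by eventually_elim (simp add: e_def field_simps)
  with F show False by simp
qed

text \<open>Zero oscillation means that upper and lower limit agree, and \<open>f\<close> is
  squeezed to the common value.\<close>

lemma tendsto_real_limsup:
  assumes K: "eventually (\<lambda>t. \<bar>f t\<bar> \<le> K) F"
    and eq: "real_limsup F f + real_limsup F (\<lambda>t. - f t) = 0"
  shows "(f \<longlongrightarrow> real_limsup F f) F"
proof (rule order_tendstoI)
  fix x assume "real_limsup F f < x"
  then show "eventually (\<lambda>t. f t < x) F"
    using K by (intro real_limsup_less[of _ K]) (auto elim: eventually_mono)
next
  fix x assume "x < real_limsup F f"
  then have "real_limsup F (\<lambda>t. - f t) < - x" using eq by linarith
  then have "eventually (\<lambda>t. - f t < - x) F"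
    using K by (intro real_limsup_less[of _ K]) (auto elim: eventually_mono)
  then show "eventually (\<lambda>t. x < f t) F" by simp
qed

lemma real_limsup_eq_lim:
  assumes F: "F \<noteq> bot" and lim: "(f \<longlongrightarrow> l) F"
  shows "real_limsup F f = l"
proof (rule antisym)
  have lo: "eventually (\<lambda>t. - (1 - l) \<le> f t) F"
    using order_tendstoD(1)[OF lim, of "l - 1"] by (auto elim: eventually_mono)
  have hi: "eventually (\<lambda>t. f t \<le> l + 1) F"
    using order_tendstoD(2)[OF lim, of "l + 1"] by (auto elim: eventually_mono)
  show "real_limsup F f \<le> l"
  proof (rule dense_ge)
    fix x assume "l < x"
    then show "real_limsup F f \<le> x"
      using order_tendstoD(2)[OF lim, of x]
      by (intro real_limsup_le[OF F lo]) (auto elim: eventually_mono)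
  qed
  show "l \<le> real_limsup F f"
  proof (rule ccontr)
    assume "\<not> l \<le> real_limsup F f"
    then obtain c where c: "real_limsup F f < c" "c < l" using dense by (auto simp: not_le)
    have "eventually (\<lambda>t. False) F"
      using real_limsup_less[OF hi c(1)] order_tendstoD(1)[OF lim c(2)]
      by eventually_elim simp
    with F show False by simp
  qed
qed

text \<open>Tannery's theorem along the net of finite subsets, where \<open>Q\<close> is both the
  range of summation and the parameter of the summand. A finite \<open>F\<close> carries all but
  little of \<open>w\<close>: on \<open>F\<close> pointwise convergence applies, and off
  \<open>F\<close> each error is at most \<open>2 * w t\<close>.\<close>

lemma dominated_sum_tendsto_infsum:
  fixes h :: "'a set \<Rightarrow> 'a \<Rightarrow> real"
  assumes w: "w summable_on A"
    and bound: "\<And>Q t. finite Q \<Longrightarrow> Q \<subseteq> A \<Longrightarrow> t \<in> A \<Longrightarrow> \<bar>h Q t\<bar> \<le> w t"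
    and lim: "\<And>t. t \<in> A \<Longrightarrow> ((\<lambda>Q. h Q t) \<longlongrightarrow> g t) (finite_subsets_at_top A)"
  shows "g summable_on A"
    and "((\<lambda>Q. sum (h Q) Q) \<longlongrightarrow> infsum g A) (finite_subsets_at_top A)"
proof -
  let ?T = "finite_subsets_at_top A"
  have gw: "\<bar>g t\<bar> \<le> w t" if "t \<in> A" for t
  proof -
    have "eventually (\<lambda>Q. \<bar>h Q t\<bar> \<le> w t) ?T"
      using bound that by (intro eventually_finite_subsets_at_top_weakI) auto
    then show ?thesis
      using tendsto_rabs[OF lim[OF that]] by (intro tendsto_upperbound) auto
  qed
  have "(\<lambda>t. norm (g t)) summable_on A"
    by (rule summable_on_comparison_test[OF w]) (auto simp: gw)
  then show g: "g summable_on A" by (rule abs_summable_summable)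
  have "((\<lambda>Q. \<Sum>t\<in>Q. h Q t - g t) \<longlongrightarrow> 0) ?T"
  proof (rule tendstoI)
    fix e :: real assume "e > 0"
    \<comment> \<open>Two sums of \<open>w\<close> within \<open>e / 8\<close> of the total differ
      by less than \<open>e / 4\<close>, so the error off \<open>F\<close> is below
      \<open>e / 2\<close>; the other half is spent on \<open>F\<close>.\<close>
    then have "eventually (\<lambda>Q. dist (sum w Q) (infsum w A) < e / 8) ?T"
      by (intro tendstoD[OF infsum_tendsto[OF w]]) simp
    then obtain F where F: "finite F" "F \<subseteq> A"
      and tail: "\<And>Q. finite Q \<Longrightarrow> F \<subseteq> Q \<Longrightarrow> Q \<subseteq> A \<Longrightarrow> dist (sum w Q) (infsum w A) < e / 8"
      by (auto simp: eventually_finite_subsets_at_top)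
    have "((\<lambda>Q. \<Sum>t\<in>F. \<bar>h Q t - g t\<bar>) \<longlongrightarrow> (\<Sum>t\<in>F. \<bar>g t - g t\<bar>)) ?T"
      using F by (intro tendsto_intros lim) auto
    then have "eventually (\<lambda>Q. (\<Sum>t\<in>F. \<bar>h Q t - g t\<bar>) < e / 2) ?T"
      using \<open>e > 0\<close> by (intro order_tendstoD) auto
    moreover have "eventually (\<lambda>Q. finite Q \<and> F \<subseteq> Q \<and> Q \<subseteq> A) ?T"
      using F by (auto simp: eventually_finite_subsets_at_top)
    ultimately show "eventually (\<lambda>Q. dist (\<Sum>t\<in>Q. h Q t - g t) 0 < e) ?T"
    proof eventually_elim
      case (elim Q)
      have "sum w (Q - F) = sum w Q - sum w F"
        using elim by (intro sum_diff) auto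
      also have "\<dots> < e / 4"
      proof -
        have "\<bar>sum w Q - infsum w A\<bar> < e / 8" "\<bar>sum w F - infsum w A\<bar> < e / 8"
          using tail[of Q] tail[of F] elim F by (simp_all add: dist_real_def)
        then show ?thesis by linarith
      qed
      finally have "sum w (Q - F) < e / 4" .
      moreover have "(\<Sum>t\<in>Q - F. \<bar>h Q t - g t\<bar>) \<le> (\<Sum>t\<in>Q - F. 2 * w t)"
      proof (rule sum_mono)
        fix t assume "t \<in> Q - F"
        then have "t \<in> A" using elim by auto
        then show "\<bar>h Q t - g t\<bar> \<le> 2 * w t" using bound[of Q t] gw[of t] elim by linarith
      qed
      moreover have "(\<Sum>t\<in>Q. \<bar>h Q t - g t\<bar>)
          = (\<Sum>t\<in>Q - F. \<bar>h Q t - g t\<bar>) + (\<Sum>t\<in>F. \<bar>h Q t - g t\<bar>)"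
        using elim by (intro sum.subset_diff) auto
      moreover have "\<bar>\<Sum>t\<in>Q. h Q t - g t\<bar> \<le> (\<Sum>t\<in>Q. \<bar>h Q t - g t\<bar>)" by (rule sum_abs)
      ultimately show ?case using elim by (simp add: sum_distrib_left[symmetric])
    qed
  qed
  from tendsto_add[OF this infsum_tendsto[OF g]]
  show "((\<lambda>Q. sum (h Q) Q) \<longlongrightarrow> infsum g A) ?T"
    by (simp add: sum.distrib[symmetric])
qed

subsection \<open>Step integrals as functionals\<close>

context stieltjes
begin

text \<open>The point sets of partitions of \<open>[a, b]\<close>. They are closed under union and
  cofinal among the finite subsets of \<open>{a..b}\<close>, so refinement becomes convergence along
  \<open>finite_subsets_at_top {a..b}\<close>.\<close>

definition admissible :: "real set \<Rightarrow> bool" where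
  "admissible Q \<longleftrightarrow> finite Q \<and> {a, b} \<subseteq> Q \<and> Q \<subseteq> {a..b}"

lemma admissible_Un: "admissible P \<Longrightarrow> admissible Q \<Longrightarrow> admissible (P \<union> Q)"
  by (auto simp: admissible_def)

lemma admissible_partition: "is_partition a b n x \<Longrightarrow> admissible (x ` {0..n})"
  using partition_bounds[of a b n x] by (auto simp: admissible_def is_partition_def image_iff)

lemma eventually_admissible:
  assumes "finite F" "F \<subseteq> {a..b}"
  shows "eventually (\<lambda>Q. admissible Q \<and> F \<subseteq> Q) (finite_subsets_at_top {a..b})"
  unfolding eventually_finite_subsets_at_top admissible_def
  using assms ab by (intro exI[of _ "insert a (insert b F)"]) auto

lemma sum_saltus_gap_superset:
  assumes "step_on a b P u" "admissible P" "admissible Q" "P \<subseteq> Q"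
  shows "sum (saltus_gap u) Q = sum (saltus_gap u) P"
proof -
  have "\<forall>t\<in>Q - P. saltus_gap u t = 0"
    using assms(2,3) saltus_gap_step_off[OF _ assms(1)] by (auto simp: admissible_def)
  then show ?thesis using assms by (intro sum.mono_neutral_right) (auto simp: admissible_def)
qed

text \<open>The integral relations are turned into functionals; \<open>THE\<close> is justified by
  \<open>DS_int_eq\<close> and \<open>RDS_int_eq\<close>.\<close>

definition DS_int :: "(real \<Rightarrow> real) \<Rightarrow> real" where
  "DS_int u = (THE I. has_DS_step_integral a b \<alpha> u I)"

definition RDS_int :: "(real \<Rightarrow> real) \<Rightarrow> real" where
  "RDS_int u = (THE I. has_RDS_step_integral a b \<alpha> u I)"

lemma DS_int_eq: "has_DS_step_integral a b \<alpha> u I \<Longrightarrow> DS_int u = I"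
  unfolding DS_int_def has_DS_step_integral_def using DS_step_sum_unique by blast

lemma is_step_with_admissible:
  assumes "is_step_with a b u n x c"
  shows "admissible (x ` {0..n})" "step_on a b (x ` {0..n}) u"
  using assms admissible_partition is_step_with_step_on[OF assms]
  by (simp_all add: is_step_with_def)

lemma has_RDS_step_integralE:
  assumes "has_RDS_step_integral a b \<alpha> u I"
  obtains Q where "admissible Q" "step_on a b Q u" "I = DS_int u - sum (saltus_gap u) Q"
proof -
  obtain n x c where S: "is_step_with a b u n x c"
    and I: "I = (\<Sum>i=0..n. u (x i) * mu_point a b \<alpha> (x i))
          + (\<Sum>i=1..n. c i * mu_open a b \<alpha> (x (i - 1)) (x i))"
    using assms by (auto simp: has_RDS_step_integral_def)
  have "DS_int u = (\<Sum>i=1..n. c i * (\<alpha> (x i) - \<alpha> (x (i - 1))))"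
    using S by (intro DS_int_eq) (auto simp: has_DS_step_integral_def)
  with DS_minus_RDS_step_sum[OF S] I have "I = DS_int u - sum (saltus_gap u) (x ` {0..n})" by simp
  with that is_step_with_admissible[OF S] show thesis by blast
qed

text \<open>Uniqueness is inherited from the DS value: two representations give
  \<open>DS_int u\<close> minus the sums of gaps over two point sets, and both sums equal the one
  over the union.\<close>

lemma RDS_int_eq:
  assumes I: "has_RDS_step_integral a b \<alpha> u I"
  shows "RDS_int u = I"
  unfolding RDS_int_def
proof (rule the_equality[where P = "has_RDS_step_integral a b \<alpha> u", OF I])
  fix J assume "has_RDS_step_integral a b \<alpha> u J"
  then obtain P where P: "admissible P" "step_on a b P u" "J = DS_int u - sum (saltus_gap u) P"
    by (rule has_RDS_step_integralE)
  obtain Q where Q: "admissible Q" "step_on a b Q u" "I = DS_int u - sum (saltus_gap u) Q"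
    using I by (rule has_RDS_step_integralE)
  show "J = I"
    using P Q sum_saltus_gap_superset[OF P(2,1) admissible_Un[OF P(1) Q(1)]]
      sum_saltus_gap_superset[OF Q(2,1) admissible_Un[OF P(1) Q(1)]] by simp
qed

lemma step_integrals:
  assumes Q: "admissible Q" and u: "step_on a b Q u"
  shows "has_DS_step_integral a b \<alpha> u (DS_int u)"
    and "has_RDS_step_integral a b \<alpha> u (RDS_int u)"
    and "DS_int u = RDS_int u + sum (saltus_gap u) Q"
proof -
  obtain n x where P: "is_partition a b n x" and x: "x ` {0..n} = Q"
    using Q ex_partition[of Q a b] by (auto simp: admissible_def)
  let ?c = "\<lambda>i. u ((x (i - 1) + x i) / 2)"
  have S: "is_step_with a b u n x ?c" using step_on_is_step_with[OF P] u x by blast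
  have "has_DS_step_integral a b \<alpha> u (\<Sum>i=1..n. ?c i * (\<alpha> (x i) - \<alpha> (x (i - 1))))"
    using S by (auto simp: has_DS_step_integral_def)
  then show "has_DS_step_integral a b \<alpha> u (DS_int u)" using DS_int_eq by simp
  have "has_RDS_step_integral a b \<alpha> u ((\<Sum>i=0..n. u (x i) * mu_point a b \<alpha> (x i))
          + (\<Sum>i=1..n. ?c i * mu_open a b \<alpha> (x (i - 1)) (x i)))"
    unfolding has_RDS_step_integral_def using S by blast
  then show R: "has_RDS_step_integral a b \<alpha> u (RDS_int u)" using RDS_int_eq by simp
  then obtain P' where P': "admissible P'" "step_on a b P' u"
      "RDS_int u = DS_int u - sum (saltus_gap u) P'"
    by (rule has_RDS_step_integralE)
  \<comment> \<open>The elimination rule supplies its own point set \<open>P'\<close>; the sums of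
    gaps over \<open>P'\<close> and \<open>Q\<close> agree through the union.\<close>
  then show "DS_int u = RDS_int u + sum (saltus_gap u) Q"
    using sum_saltus_gap_superset[OF P'(2,1) admissible_Un[OF P'(1) Q]]
      sum_saltus_gap_superset[OF u Q admissible_Un[OF P'(1) Q]] by simp
qed

lemma has_DS_step_integralE:
  assumes "has_DS_step_integral a b \<alpha> u I"
  obtains Q where "admissible Q" "step_on a b Q u" "I = DS_int u"
proof -
  obtain n x c where S: "is_step_with a b u n x c"
    using assms by (auto simp: has_DS_step_integral_def)
  show thesis using that[OF is_step_with_admissible[OF S]] DS_int_eq[OF assms] by simp
qed

text \<open>Over a common point set both integrals are sums of function values with weights that are
  nonnegative by monotonicity of \<open>\<alpha>\<close>.\<close>

lemma step_int_mono:
  assumes Q: "admissible Q" and u: "step_on a b Q u" and v: "step_on a b Q v"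
    and uv: "\<And>t. t \<in> {a..b} \<Longrightarrow> u t \<le> v t"
  shows "DS_int u \<le> DS_int v" "RDS_int u \<le> RDS_int v"
proof -
  obtain n x where P: "is_partition a b n x" and x: "x ` {0..n} = Q"
    using Q ex_partition[of Q a b] by (auto simp: admissible_def)
  let ?m = "\<lambda>i. (x (i - 1) + x i) / 2"
  have S: "is_step_with a b u n x (\<lambda>i. u (?m i))" "is_step_with a b v n x (\<lambda>i. v (?m i))"
    using step_on_is_step_with[OF P] u v x by blast+
  have bounds: "a \<le> x (i - 1)" "x (i - 1) < x i" "x i \<le> b" if "i \<in> {1..n}" for i
    using that partition_bounds[OF P] partition_less[OF P, of "i - 1" i] by auto
  then have m: "u (?m i) \<le> v (?m i)" if "i \<in> {1..n}" for i
    using bounds[OF that] by (intro uv) auto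
  have "DS_int u = (\<Sum>i=1..n. u (?m i) * (\<alpha> (x i) - \<alpha> (x (i - 1))))"
    using S(1) by (intro DS_int_eq) (auto simp: has_DS_step_integral_def)
  also have "\<dots> \<le> (\<Sum>i=1..n. v (?m i) * (\<alpha> (x i) - \<alpha> (x (i - 1))))"
  proof (rule sum_mono)
    fix i assume i: "i \<in> {1..n}"
    have "\<alpha> (x (i - 1)) \<le> \<alpha> (x i)" using bounds[OF i] by (intro mono_onD[OF mono]) auto
    then show "u (?m i) * (\<alpha> (x i) - \<alpha> (x (i - 1))) \<le> v (?m i) * (\<alpha> (x i) - \<alpha> (x (i - 1)))"
      using m[OF i] by (intro mult_right_mono) auto
  qed
  also have "\<dots> = DS_int v"
    using S(2) by (intro DS_int_eq[symmetric]) (auto simp: has_DS_step_integral_def)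
  finally show "DS_int u \<le> DS_int v" .
  have "RDS_int u = (\<Sum>i=0..n. u (x i) * mu_point a b \<alpha> (x i))
          + (\<Sum>i=1..n. u (?m i) * mu_open a b \<alpha> (x (i - 1)) (x i))"
    using S(1) unfolding has_RDS_step_integral_def by (intro RDS_int_eq) (auto simp: has_RDS_step_integral_def)
  also have "\<dots> \<le> (\<Sum>i=0..n. v (x i) * mu_point a b \<alpha> (x i))
          + (\<Sum>i=1..n. v (?m i) * mu_open a b \<alpha> (x (i - 1)) (x i))"
  proof (intro add_mono sum_mono mult_right_mono m)
    fix i assume "i \<in> {0..n}"
    then have "x i \<in> {a..b}" using partition_bounds[OF P] by auto
    then show "u (x i) \<le> v (x i)" "0 \<le> mu_point a b \<alpha> (x i)"
      using uv jump_r_nonneg jump_l_nonneg by (auto simp: mu_point_eq)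
  qed (use bounds mu_open_nonneg in auto)
  also have "\<dots> = RDS_int v"
    using S(2) by (intro RDS_int_eq[symmetric]) (auto simp: has_RDS_step_integral_def)
  finally show "RDS_int u \<le> RDS_int v" .
qed

text \<open>The comparison of the two step sums is applied to the constant 1. Its gaps vanish
  because it is a step function over the empty point set, and the open intervals have nonnegative
  mass.\<close>

lemma sum_jumps_le:
  assumes "admissible Q"
  shows "(\<Sum>t\<in>Q. jump_r t + jump_l t) \<le> \<alpha> b - \<alpha> a"
proof -
  obtain n x where P: "is_partition a b n x" and x: "x ` {0..n} = Q"
    using assms ex_partition[of Q a b] by (auto simp: admissible_def)
  have S: "is_step_with a b (\<lambda>_. 1) n x (\<lambda>_. 1)" using P by (simp add: is_step_with_def)
  have "step_on a b {} (\<lambda>_. 1)" by (simp add: step_on_def)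
  then have "sum (saltus_gap (\<lambda>_. 1)) (x ` {0..n}) = 0"
    using admissible_partition[OF P]
    by (intro sum.neutral ballI saltus_gap_step_off[of "{}"]) (auto simp: admissible_def)
  moreover have "0 \<le> (\<Sum>i=1..n. mu_open a b \<alpha> (x (i - 1)) (x i))"
    using partition_bounds[OF P] partition_less[OF P]
    by (intro sum_nonneg mu_open_nonneg) auto
  moreover have "(\<Sum>i=1..n. \<alpha> (x i) - \<alpha> (x (i - 1))) = \<alpha> b - \<alpha> a"
    using P sum_lessThan_telescope[of "\<lambda>i. \<alpha> (x i)" n]
    by (simp add: sum_from_1 is_partition_def del: One_nat_def)
  moreover have "(\<Sum>i=0..n. mu_point a b \<alpha> (x i)) = (\<Sum>t\<in>Q. jump_r t + jump_l t)"
    unfolding x[symmetric] by (simp add: sum.reindex[OF partition_inj[OF P]] mu_point_eq)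
  ultimately show ?thesis using DS_minus_RDS_step_sum[OF S] by simp
qed

lemma jumps_summable: "jump_r summable_on {a..b}" "jump_l summable_on {a..b}"
proof -
  have "eventually (\<lambda>Q. (\<Sum>t\<in>Q. jump_r t + jump_l t) \<le> \<alpha> b - \<alpha> a) (finite_subsets_at_top {a..b})"
    using eventually_admissible[of "{}"] by (auto elim!: eventually_mono intro: sum_jumps_le)
  then have sm: "(\<lambda>t. jump_r t + jump_l t) summable_on {a..b}"
    using jump_r_nonneg jump_l_nonneg
    by (intro nonneg_bounded_partial_sums_imp_summable_on) auto
  show "jump_r summable_on {a..b}" "jump_l summable_on {a..b}"
    by (rule summable_on_comparison_test[OF sm]; use jump_r_nonneg jump_l_nonneg in force)+
qed

end

subsection \<open>The upper step functions of a bounded function\<close>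

text \<open>For bounded \<open>f\<close> this is the least step function over \<open>Q\<close> above
  \<open>f\<close> on \<open>[a, b]\<close>, by \<open>upper_step_ge\<close> and
  \<open>upper_step_least\<close>. The supremum is over a nonempty set for \<open>t\<close> in
  \<open>{a..b} - Q\<close>, since \<open>t\<close> lies in its own component.\<close>

definition upper_step :: "real \<Rightarrow> real \<Rightarrow> (real \<Rightarrow> real) \<Rightarrow> real set \<Rightarrow> real \<Rightarrow> real" where
  "upper_step a b f Q t = (if t \<in> Q then f t else Sup (f ` component a b Q t))"

lemma step_on_upper_step: "step_on a b Q (upper_step a b f Q)"
  unfolding step_on_def
proof (intro ballI)
  fix t s assume "t \<in> {a..b}" and s: "s \<in> component a b Q t"
  then have "component a b Q s = component a b Q t" "t \<notin> Q" "s \<notin> Q"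
    using component_eq component_mem by blast+
  then show "upper_step a b f Q s = upper_step a b f Q t" by (simp add: upper_step_def)
qed

lemma upper_step_le:
  assumes "t \<in> {a..b}" "f t \<le> c" "\<And>s. s \<in> component a b Q t \<Longrightarrow> f s \<le> c"
  shows "upper_step a b f Q t \<le> c"
  using assms component_self[of t a b Q]
  by (auto simp: upper_step_def intro!: cSUP_least)

locale stieltjes_bounded = stieltjes +
  fixes f :: "real \<Rightarrow> real" and K :: real
  assumes K: "t \<in> {a..b} \<Longrightarrow> \<bar>f t\<bar> \<le> K"
begin

lemma f_le: "t \<in> {a..b} \<Longrightarrow> f t \<le> K" and f_ge: "t \<in> {a..b} \<Longrightarrow> - K \<le> f t"
  using K[of t] by auto

lemma upper_step_ge:
  assumes "t \<in> {a..b}"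
  shows "f t \<le> upper_step a b f Q t"
proof -
  have "bdd_above (f ` component a b Q t)"
    using component_subset f_le by (intro bdd_aboveI2[of _ _ K]) blast
  then show ?thesis
    using component_self[OF assms, of Q] by (auto simp: upper_step_def intro: cSUP_upper)
qed

lemma upper_step_bound:
  assumes "t \<in> {a..b}"
  shows "\<bar>upper_step a b f Q t\<bar> \<le> K"
proof -
  have "upper_step a b f Q t \<le> K"
    using component_subset[of a b Q t] by (intro upper_step_le assms f_le) auto
  then show ?thesis using upper_step_ge[OF assms, of Q] f_ge[OF assms] by linarith
qed

lemma upper_step_least:
  assumes "step_on a b Q u" "\<And>t. t \<in> {a..b} \<Longrightarrow> f t \<le> u t" "t \<in> {a..b}"
  shows "upper_step a b f Q t \<le> u t"
proof (rule upper_step_le[OF assms(3)])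
  fix s assume s: "s \<in> component a b Q t"
  then have "u s = u t" "s \<in> {a..b}"
    using assms(1,3) component_subset[of a b Q t] by (auto simp: step_on_def)
  then show "f s \<le> u t" using assms(2) by metis
qed (use assms in auto)

section \<open>One-sided limits of the upper step functions\<close>

lemma eventually_right_bound:
  assumes "a \<le> t" "t < b"
  shows "eventually (\<lambda>s. \<bar>f s\<bar> \<le> K) (at_right t)"
    "eventually (\<lambda>s. - K \<le> f s) (at_right t)" "eventually (\<lambda>s. f s \<le> K) (at_right t)"
proof -
  show "eventually (\<lambda>s. \<bar>f s\<bar> \<le> K) (at_right t)"
    unfolding eventually_at_right[OF assms(2)] using assms K by (intro exI[of _ b]) auto
  then show "eventually (\<lambda>s. - K \<le> f s) (at_right t)" "eventually (\<lambda>s. f s \<le> K) (at_right t)"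
    by (auto elim: eventually_mono)
qed

lemma eventually_left_bound:
  assumes "a < t" "t \<le> b"
  shows "eventually (\<lambda>s. \<bar>f s\<bar> \<le> K) (at_left t)"
    "eventually (\<lambda>s. - K \<le> f s) (at_left t)" "eventually (\<lambda>s. f s \<le> K) (at_left t)"
proof -
  show "eventually (\<lambda>s. \<bar>f s\<bar> \<le> K) (at_left t)"
    unfolding eventually_at_left[OF assms(1)] using assms K by (intro exI[of _ a]) auto
  then show "eventually (\<lambda>s. - K \<le> f s) (at_left t)" "eventually (\<lambda>s. f s \<le> K) (at_left t)"
    by (auto elim: eventually_mono)
qed

text \<open>Just right of \<open>t\<close> the upper step function is constant and dominates
  \<open>f\<close>, so this constant is an eventual upper bound of \<open>f\<close>.\<close>

lemma rlim_upper_step_ge: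
  assumes "finite Q" "a \<le> t" "t < b"
  shows "real_limsup (at_right t) f \<le> rlim b (upper_step a b f Q) t"
proof (rule real_limsup_le[OF _ eventually_right_bound(2)])
  have "eventually (\<lambda>s. s \<in> {t<..<b}) (at_right t)"
    using assms by (auto simp: eventually_at_right[of t b])
  then show "eventually (\<lambda>s. f s \<le> rlim b (upper_step a b f Q) t) (at_right t)"
    using step_on_right(1)[OF assms(1) step_on_upper_step assms(2,3), of f]
  proof eventually_elim
    case (elim s)
    then show ?case using upper_step_ge[of s Q] assms by simp
  qed
qed (use assms in \<open>auto simp: trivial_limit_at_right_real\<close>)

lemma llim_upper_step_ge:
  assumes "finite Q" "a < t" "t \<le> b"
  shows "real_limsup (at_left t) f \<le> llim a (upper_step a b f Q) t"
proof (rule real_limsup_le[OF _ eventually_left_bound(2)])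
  have "eventually (\<lambda>s. s \<in> {a<..<t}) (at_left t)"
    using assms by (auto simp: eventually_at_left[of a t])
  then show "eventually (\<lambda>s. f s \<le> llim a (upper_step a b f Q) t) (at_left t)"
    using step_on_left(1)[OF assms(1) step_on_upper_step assms(2,3), of f]
  proof eventually_elim
    case (elim s)
    then show ?case using upper_step_ge[of s Q] assms by simp
  qed
qed (use assms in \<open>auto simp: trivial_limit_at_left_real\<close>)

text \<open>The bound from below holds for every finite \<open>Q\<close>. From above, if
  \<open>f < d\<close> on \<open>(t, q)\<close>, then as soon as \<open>t\<close> and
  \<open>q\<close> belong to \<open>Q\<close> no component meeting \<open>(t, q)\<close> reaches
  outside it, so the suprema there are at most \<open>d\<close>.\<close>

lemma rlim_upper_step_tendsto:
  assumes t: "a \<le> t" "t < b"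
  shows "((\<lambda>Q. rlim b (upper_step a b f Q) t) \<longlongrightarrow> real_limsup (at_right t) f)
    (finite_subsets_at_top {a..b})"
proof (rule order_tendstoI)
  fix c assume "c < real_limsup (at_right t) f"
  then show "eventually (\<lambda>Q. c < rlim b (upper_step a b f Q) t) (finite_subsets_at_top {a..b})"
    using rlim_upper_step_ge[OF _ t]
    by (intro eventually_finite_subsets_at_top_weakI) (blast intro: less_le_trans)
next
  fix c assume "real_limsup (at_right t) f < c"
  \<comment> \<open>A supremum of values below \<open>d\<close> is only known to be
    \<open>\<le> d\<close>; the room between \<open>d\<close> and \<open>c\<close> restores
    strictness.\<close>
  then obtain d where d: "real_limsup (at_right t) f < d" "d < c" using dense by blast
  obtain p where p: "t < p" "\<And>s. t < s \<Longrightarrow> s < p \<Longrightarrow> f s < d"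
    using real_limsup_less[OF eventually_right_bound(3)[OF t] d(1)]
    by (auto simp: eventually_at_right[OF t(2)])
  \<comment> \<open>Cut off at \<open>b\<close> so that \<open>q\<close> is available as a partition
    point.\<close>
  define q where "q = min p b"
  have q: "t < q" "q \<le> b" "\<And>s. t < s \<Longrightarrow> s < q \<Longrightarrow> f s < d" using p t by (auto simp: q_def)
  have "eventually (\<lambda>Q. admissible Q \<and> {t, q} \<subseteq> Q) (finite_subsets_at_top {a..b})"
    using t q by (intro eventually_admissible) auto
  then show "eventually (\<lambda>Q. rlim b (upper_step a b f Q) t < c) (finite_subsets_at_top {a..b})"
  proof eventually_elim
    case (elim Q)
    have le: "upper_step a b f Q s \<le> d" if s: "t < s" "s < q" for s
    proof (rule upper_step_le)
      show "f r \<le> d" if "r \<in> component a b Q s" for r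
        using component_interval[of t Q q s a b] that elim s q(3)[of r] by auto
    qed (use s t q less_imp_le[OF q(3)[OF s]] in auto)
    have "eventually (\<lambda>s. s \<in> {t<..<q}) (at_right t)"
      using q by (auto simp: eventually_at_right[of t q])
    moreover have "eventually (\<lambda>s. upper_step a b f Q s = rlim b (upper_step a b f Q) t) (at_right t)"
      using elim t by (intro step_on_right(1)) (auto simp: admissible_def intro: step_on_upper_step)
    ultimately have "eventually (\<lambda>s. rlim b (upper_step a b f Q) t \<le> d) (at_right t)"
      by eventually_elim (use le in force)
    then show ?case using d(2) by (simp add: eventually_const_iff trivial_limit_at_right_real)
  qed
qed

lemma llim_upper_step_tendsto:
  assumes t: "a < t" "t \<le> b"
  shows "((\<lambda>Q. llim a (upper_step a b f Q) t) \<longlongrightarrow> real_limsup (at_left t) f)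
    (finite_subsets_at_top {a..b})"
proof (rule order_tendstoI)
  fix c assume "c < real_limsup (at_left t) f"
  then show "eventually (\<lambda>Q. c < llim a (upper_step a b f Q) t) (finite_subsets_at_top {a..b})"
    using llim_upper_step_ge[OF _ t]
    by (intro eventually_finite_subsets_at_top_weakI) (blast intro: less_le_trans)
next
  fix c assume "real_limsup (at_left t) f < c"
  then obtain d where d: "real_limsup (at_left t) f < d" "d < c" using dense by blast
  obtain p where p: "p < t" "\<And>s. p < s \<Longrightarrow> s < t \<Longrightarrow> f s < d"
    using real_limsup_less[OF eventually_left_bound(3)[OF t] d(1)]
    by (auto simp: eventually_at_left[OF t(1)])
  define q where "q = max p a"
  have q: "q < t" "a \<le> q" "\<And>s. q < s \<Longrightarrow> s < t \<Longrightarrow> f s < d" using p t by (auto simp: q_def)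
  have "eventually (\<lambda>Q. admissible Q \<and> {q, t} \<subseteq> Q) (finite_subsets_at_top {a..b})"
    using t q by (intro eventually_admissible) auto
  then show "eventually (\<lambda>Q. llim a (upper_step a b f Q) t < c) (finite_subsets_at_top {a..b})"
  proof eventually_elim
    case (elim Q)
    have le: "upper_step a b f Q s \<le> d" if s: "q < s" "s < t" for s
    proof (rule upper_step_le)
      show "f r \<le> d" if "r \<in> component a b Q s" for r
        using component_interval[of q Q t s a b] that elim s q(3)[of r] by auto
    qed (use s t q less_imp_le[OF q(3)[OF s]] in auto)
    have "eventually (\<lambda>s. s \<in> {q<..<t}) (at_left t)"
      using q by (auto simp: eventually_at_left[of q t])
    moreover have "eventually (\<lambda>s. upper_step a b f Q s = llim a (upper_step a b f Q) t) (at_left t)"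
      using elim t by (intro step_on_left(1)) (auto simp: admissible_def intro: step_on_upper_step)
    ultimately have "eventually (\<lambda>s. llim a (upper_step a b f Q) t \<le> d) (at_left t)"
      by eventually_elim (use le in force)
    then show ?case using d(2) by (simp add: eventually_const_iff trivial_limit_at_left_real)
  qed
qed

lemma rlim_upper_step_bound:
  assumes "finite Q" "t \<in> {a..b}"
  shows "\<bar>rlim b (upper_step a b f Q) t\<bar> \<le> K"
proof (cases "t = b")
  case True
  then show ?thesis using upper_step_bound[OF assms(2)] by (simp add: rlim_def)
next
  case False
  have "eventually (\<lambda>s. s \<in> {t<..<b}) (at_right t)"
    using assms False eventually_at_right_real[of t b] by simp
  moreover have "eventually (\<lambda>s. upper_step a b f Q s = rlim b (upper_step a b f Q) t) (at_right t)"
    using assms False by (intro step_on_right(1)) (auto intro: step_on_upper_step)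
  ultimately have "eventually (\<lambda>s. \<bar>rlim b (upper_step a b f Q) t\<bar> \<le> K) (at_right t)"
  proof eventually_elim
    case (elim s)
    then show ?case using upper_step_bound[of s Q] assms by simp
  qed
  then show ?thesis by (simp add: eventually_const_iff trivial_limit_at_right_real)
qed

lemma llim_upper_step_bound:
  assumes "finite Q" "t \<in> {a..b}"
  shows "\<bar>llim a (upper_step a b f Q) t\<bar> \<le> K"
proof (cases "t = a")
  case True
  then show ?thesis using upper_step_bound[OF assms(2)] by (simp add: llim_def)
next
  case False
  have "eventually (\<lambda>s. s \<in> {a<..<t}) (at_left t)"
    using assms False eventually_at_left_real[of a t] by simp
  moreover have "eventually (\<lambda>s. upper_step a b f Q s = llim a (upper_step a b f Q) t) (at_left t)"
    using assms False by (intro step_on_left(1)) (auto intro: step_on_upper_step)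
  ultimately have "eventually (\<lambda>s. \<bar>llim a (upper_step a b f Q) t\<bar> \<le> K) (at_left t)"
  proof eventually_elim
    case (elim s)
    then show ?case using upper_step_bound[of s Q] assms by simp
  qed
  then show ?thesis by (simp add: eventually_const_iff trivial_limit_at_left_real)
qed

text \<open>Stated for an abstract relation and functional so that it serves DS and RDS alike. Each
  upper step function over an admissible set competes in the infimum; conversely, a near-optimal
  competitor with point set \<open>P\<close> dominates the upper step function of every
  \<open>Q\<close> containing \<open>P\<close>.\<close>

lemma step_functional_tendsto_Inf:
  fixes J :: "(real \<Rightarrow> real) \<Rightarrow> real"
  assumes rep: "\<And>u I. has u I \<Longrightarrow> \<exists>Q. admissible Q \<and> step_on a b Q u \<and> I = J u"
    and has: "\<And>Q u. admissible Q \<Longrightarrow> step_on a b Q u \<Longrightarrow> has u (J u)"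
    and J_mono: "\<And>Q u v. admissible Q \<Longrightarrow> step_on a b Q u \<Longrightarrow> step_on a b Q v
      \<Longrightarrow> (\<And>t. t \<in> {a..b} \<Longrightarrow> u t \<le> v t) \<Longrightarrow> J u \<le> J v"
  shows "((\<lambda>Q. J (upper_step a b f Q)) \<longlongrightarrow> Inf {I. \<exists>u. (\<forall>t\<in>{a..b}. f t \<le> u t) \<and> has u I})
    (finite_subsets_at_top {a..b})"
    (is "(_ \<longlongrightarrow> Inf ?S) ?T")
proof -
  have step: "J (upper_step a b f Q) \<in> ?S" if "admissible Q" for Q
    using has[OF that step_on_upper_step] upper_step_ge by blast
  have ne: "?S \<noteq> {}" using step[of "{a, b}"] ab by (auto simp: admissible_def)
  have bdd: "bdd_below ?S"
  proof (rule bdd_belowI)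
    fix I assume "I \<in> ?S"
    then obtain u where u: "\<forall>t\<in>{a..b}. f t \<le> u t" "has u I" by blast
    then obtain Q where Q: "admissible Q" "step_on a b Q u" "I = J u" using rep by blast
    \<comment> \<open>The constant \<open>- K\<close> is a step function over every point set, so
      one number bounds all competitors from below.\<close>
    have "J (\<lambda>_. - K) \<le> J u"
    proof (rule J_mono[OF Q(1) _ Q(2)])
      show "- K \<le> u t" if "t \<in> {a..b}" for t using f_ge[OF that] u(1) that by force
    qed (simp add: step_on_def)
    then show "J (\<lambda>_. - K) \<le> I" using Q(3) by simp
  qed
  show ?thesis
  proof (rule order_tendstoI)
    fix c assume c: "c < Inf ?S"
    show "eventually (\<lambda>Q. c < J (upper_step a b f Q)) ?T"
      using eventually_admissible[of "{}"]
      by (auto elim!: eventually_mono intro: less_le_trans[OF c] cInf_lower[OF step bdd])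
  next
    fix c assume "Inf ?S < c"
    from cInf_lessD[OF ne this] obtain I u where I: "I < c" "\<forall>t\<in>{a..b}. f t \<le> u t" "has u I"
      by blast
    then obtain P where P: "admissible P" "step_on a b P u" "I = J u" using rep by blast
    have "eventually (\<lambda>Q. admissible Q \<and> P \<subseteq> Q) ?T"
      using P(1) by (intro eventually_admissible) (auto simp: admissible_def)
    then show "eventually (\<lambda>Q. J (upper_step a b f Q) < c) ?T"
    proof eventually_elim
      case (elim Q)
      then have "step_on a b Q u" using step_on_mono[OF P(2)] by blast
      then have "J (upper_step a b f Q) \<le> J u"
        using elim I(2) by (intro J_mono[of Q] step_on_upper_step upper_step_least) auto
      then show ?case using I(1) P(3) by simp
    qed
  qed
qed

text \<open>The limit of the gaps of the upper step functions, hence the summand of the series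
  \<open>s f\<close>. At an endpoint the upper limit pointing out of \<open>[a, b]\<close> has no
  meaning for \<open>f\<close>, but its factor is 0.\<close>

definition limsup_gap :: "real \<Rightarrow> real" where
  "limsup_gap t = jump_r t * (real_limsup (at_right t) f - f t)
    + jump_l t * (real_limsup (at_left t) f - f t)"

lemma saltus_gap_upper_step_tendsto:
  assumes t: "t \<in> {a..b}"
  shows "((\<lambda>Q. saltus_gap (upper_step a b f Q) t) \<longlongrightarrow> limsup_gap t)
    (finite_subsets_at_top {a..b})" (is "(_ \<longlongrightarrow> _) ?T")
proof -
  \<comment> \<open>Once \<open>t\<close> belongs to \<open>Q\<close>, the upper step function takes
    the value \<open>f t\<close> at \<open>t\<close>.\<close>
  have "eventually (\<lambda>Q. admissible Q \<and> {t} \<subseteq> Q) ?T" using t by (intro eventually_admissible) auto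
  then have f: "eventually (\<lambda>Q. f t = upper_step a b f Q t) ?T"
    by eventually_elim (simp add: upper_step_def)
  \<comment> \<open>At \<open>t = b\<close> both sides vanish with \<open>jump_r b\<close>; likewise
    for the left jump at \<open>t = a\<close>.\<close>
  have r: "((\<lambda>Q. jump_r t * (rlim b (upper_step a b f Q) t - f t))
      \<longlongrightarrow> jump_r t * (real_limsup (at_right t) f - f t)) ?T"
    using t rlim_upper_step_tendsto[of t] by (cases "t = b") (auto intro!: tendsto_intros)
  have l: "((\<lambda>Q. jump_l t * (llim a (upper_step a b f Q) t - f t))
      \<longlongrightarrow> jump_l t * (real_limsup (at_left t) f - f t)) ?T"
    using t llim_upper_step_tendsto[of t] by (cases "t = a") (auto intro!: tendsto_intros)
  show ?thesis
    unfolding limsup_gap_def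
    by (rule Lim_transform_eventually[OF tendsto_add[OF r l]])
       (use f in \<open>auto elim!: eventually_mono simp: saltus_gap_def\<close>)
qed

lemma saltus_gap_upper_step_bound:
  assumes "finite Q" "t \<in> {a..b}"
  shows "\<bar>saltus_gap (upper_step a b f Q) t\<bar> \<le> 2 * K * (jump_r t + jump_l t)"
proof -
  have "\<bar>rlim b (upper_step a b f Q) t - upper_step a b f Q t\<bar> \<le> 2 * K"
    "\<bar>llim a (upper_step a b f Q) t - upper_step a b f Q t\<bar> \<le> 2 * K"
    using rlim_upper_step_bound[OF assms] llim_upper_step_bound[OF assms]
      upper_step_bound[OF assms(2), of Q] by linarith+
  then have "\<bar>jump_r t * (rlim b (upper_step a b f Q) t - upper_step a b f Q t)\<bar> \<le> jump_r t * (2 * K)"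
    "\<bar>jump_l t * (llim a (upper_step a b f Q) t - upper_step a b f Q t)\<bar> \<le> jump_l t * (2 * K)"
    using jump_r_nonneg[OF assms(2)] jump_l_nonneg[OF assms(2)]
    by (auto simp: abs_mult intro: mult_left_mono)
  then show ?thesis unfolding saltus_gap_def by (simp add: algebra_simps)
qed

text \<open>The identity of \<open>step_integrals\<close> for the upper step functions is passed to
  the limit in \<open>Q\<close>: the integrals converge by
  \<open>step_functional_tendsto_Inf\<close>, the sums of gaps by dominated convergence with
  majorant \<open>2 * K * (jump_r t + jump_l t)\<close>.\<close>

lemma limsup_gap_summable: "limsup_gap summable_on {a..b}"
  and DS_upper_eq: "DS_upper a b \<alpha> f = RDS_upper a b \<alpha> f + infsum limsup_gap {a..b}"
proof -
  let ?T = "finite_subsets_at_top {a..b}"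
  have w: "(\<lambda>t. 2 * K * (jump_r t + jump_l t)) summable_on {a..b}"
    by (intro summable_on_cmult_right summable_on_add jumps_summable)
  note dom = dominated_sum_tendsto_infsum[OF w saltus_gap_upper_step_bound
      saltus_gap_upper_step_tendsto]
  show "limsup_gap summable_on {a..b}" using dom(1) by simp
  have "((\<lambda>Q. RDS_int (upper_step a b f Q)) \<longlongrightarrow> RDS_upper a b \<alpha> f) ?T"
    unfolding RDS_upper_def
  proof (rule step_functional_tendsto_Inf)
    fix u I assume I: "has_RDS_step_integral a b \<alpha> u I"
    then show "\<exists>Q. admissible Q \<and> step_on a b Q u \<and> I = RDS_int u"
      using RDS_int_eq[OF I] by (auto elim: has_RDS_step_integralE)
  qed (use step_integrals step_int_mono in blast)+
  from tendsto_add[OF this dom(2)]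
  have "((\<lambda>Q. RDS_int (upper_step a b f Q) + sum (saltus_gap (upper_step a b f Q)) Q)
      \<longlongrightarrow> RDS_upper a b \<alpha> f + infsum limsup_gap {a..b}) ?T"
    by simp
  moreover have "eventually (\<lambda>Q. RDS_int (upper_step a b f Q) + sum (saltus_gap (upper_step a b f Q)) Q
      = DS_int (upper_step a b f Q)) ?T"
    using eventually_admissible[of "{}"] step_integrals(3)[OF _ step_on_upper_step]
    by (auto elim!: eventually_mono)
  ultimately have "((\<lambda>Q. DS_int (upper_step a b f Q))
      \<longlongrightarrow> RDS_upper a b \<alpha> f + infsum limsup_gap {a..b}) ?T"
    by (rule Lim_transform_eventually)
  moreover have "((\<lambda>Q. DS_int (upper_step a b f Q)) \<longlongrightarrow> DS_upper a b \<alpha> f) ?T"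
    unfolding DS_upper_def
  proof (rule step_functional_tendsto_Inf)
    fix u I assume "has_DS_step_integral a b \<alpha> u I"
    then show "\<exists>Q. admissible Q \<and> step_on a b Q u \<and> I = DS_int u"
      by (auto elim: has_DS_step_integralE)
  qed (use step_integrals step_int_mono in blast)+
  ultimately show "DS_upper a b \<alpha> f = RDS_upper a b \<alpha> f + infsum limsup_gap {a..b}"
    using tendsto_unique[OF finite_subsets_at_top_neq_bot] by blast
qed

text \<open>Step functions \<open>v \<le> f \<le> u\<close> are compared over the union of their
  point sets; the constants \<open>- K\<close> and \<open>K\<close> make both families
  nonempty.\<close>

lemma RDS_lower_le_upper: "RDS_lower a b \<alpha> f \<le> RDS_upper a b \<alpha> f"
proof -
  have const: "\<exists>I. has_RDS_step_integral a b \<alpha> (\<lambda>_. c) I" for c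
  proof -
    have "admissible {a, b}" "step_on a b {a, b} (\<lambda>_. c)"
      using ab by (simp_all add: admissible_def step_on_def)
    then show ?thesis using step_integrals(2) by blast
  qed
  show ?thesis
    unfolding RDS_lower_def RDS_upper_def
  proof (rule cSup_least)
    show "{I. \<exists>v. (\<forall>t\<in>{a..b}. v t \<le> f t) \<and> has_RDS_step_integral a b \<alpha> v I} \<noteq> {}"
    proof -
      obtain I where "has_RDS_step_integral a b \<alpha> (\<lambda>_. - K) I" using const by blast
      then show ?thesis using f_ge by (intro ex_in_conv[THEN iffD1] exI[of _ I] CollectI exI[of _ "\<lambda>_. - K"]) simp
    qed
    fix I assume "I \<in> {I. \<exists>v. (\<forall>t\<in>{a..b}. v t \<le> f t) \<and> has_RDS_step_integral a b \<alpha> v I}"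
    then obtain v where v: "\<forall>t\<in>{a..b}. v t \<le> f t" "has_RDS_step_integral a b \<alpha> v I" by blast
    then obtain P where P: "admissible P" "step_on a b P v" by (blast elim: has_RDS_step_integralE)
    show "I \<le> Inf {I. \<exists>u. (\<forall>t\<in>{a..b}. f t \<le> u t) \<and> has_RDS_step_integral a b \<alpha> u I}"
    proof (rule cInf_greatest)
      show "{I. \<exists>u. (\<forall>t\<in>{a..b}. f t \<le> u t) \<and> has_RDS_step_integral a b \<alpha> u I} \<noteq> {}"
      proof -
        obtain I where "has_RDS_step_integral a b \<alpha> (\<lambda>_. K) I" using const by blast
        then show ?thesis using f_le by (intro ex_in_conv[THEN iffD1] exI[of _ I] CollectI exI[of _ "\<lambda>_. K"]) simp
      qed
      fix J assume "J \<in> {I. \<exists>u. (\<forall>t\<in>{a..b}. f t \<le> u t) \<and> has_RDS_step_integral a b \<alpha> u I}"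
      then obtain u where u: "\<forall>t\<in>{a..b}. f t \<le> u t" "has_RDS_step_integral a b \<alpha> u J" by blast
      then obtain Q where Q: "admissible Q" "step_on a b Q u" by (blast elim: has_RDS_step_integralE)
      have "RDS_int v \<le> RDS_int u"
      proof (rule step_int_mono(2)[OF admissible_Un[OF P(1) Q(1)]])
        show "v t \<le> u t" if "t \<in> {a..b}" for t
          using bspec[OF u(1) that] bspec[OF v(1) that] by simp
      qed (use step_on_mono[OF P(2)] step_on_mono[OF Q(2)] in auto)
      then show "I \<le> J" using RDS_int_eq u(2) v(2) by metis
    qed
  qed
qed

end

section \<open>Lower integrals by reflection, and sums over the saltus sets\<close>

lemma is_step_with_uminus:
  "is_step_with a b u n x c \<Longrightarrow> is_step_with a b (\<lambda>t. - u t) n x (\<lambda>i. - c i)"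
  by (simp add: is_step_with_def)

lemma has_RDS_step_integral_uminus:
  assumes "has_RDS_step_integral a b \<alpha> u I"
  shows "has_RDS_step_integral a b \<alpha> (\<lambda>t. - u t) (- I)"
proof -
  obtain n x c where "is_step_with a b u n x c"
    "I = (\<Sum>i=0..n. u (x i) * mu_point a b \<alpha> (x i))
          + (\<Sum>i=1..n. c i * mu_open a b \<alpha> (x (i - 1)) (x i))"
    using assms by (auto simp: has_RDS_step_integral_def)
  then show ?thesis
    unfolding has_RDS_step_integral_def
    by (intro exI[of _ n] exI[of _ x] exI[of _ "\<lambda>i. - c i"])
       (simp add: is_step_with_uminus sum_negf)
qed

lemma has_DS_step_integral_uminus:
  assumes "has_DS_step_integral a b \<alpha> u I"
  shows "has_DS_step_integral a b \<alpha> (\<lambda>t. - u t) (- I)"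
proof -
  obtain n x c where "is_step_with a b u n x c" "I = (\<Sum>i=1..n. c i * (\<alpha> (x i) - \<alpha> (x (i - 1))))"
    using assms by (auto simp: has_DS_step_integral_def)
  then show ?thesis
    unfolding has_DS_step_integral_def
    by (intro exI[of _ n] exI[of _ x] exI[of _ "\<lambda>i. - c i"])
       (simp add: is_step_with_uminus sum_negf)
qed

lemma Sup_eq_uminus_Inf:
  fixes f :: "real \<Rightarrow> real"
  assumes "\<And>u I. has u I \<Longrightarrow> has (\<lambda>t. - u t) (- I :: real)"
  shows "Sup {I. \<exists>v. (\<forall>t\<in>A. v t \<le> f t) \<and> has v I}
    = - Inf {I. \<exists>u. (\<forall>t\<in>A. - f t \<le> u t) \<and> has u I}"
proof -
  have "{I. \<exists>v. (\<forall>t\<in>A. v t \<le> f t) \<and> has v I}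
      = uminus ` {I. \<exists>u. (\<forall>t\<in>A. - f t \<le> u t) \<and> has u I}" (is "?L = uminus ` ?R")
  proof (intro equalityI subsetI)
    fix I assume "I \<in> ?L"
    then obtain v where "\<forall>t\<in>A. v t \<le> f t" "has v I" by blast
    then have "(\<forall>t\<in>A. - f t \<le> - v t) \<and> has (\<lambda>t. - v t) (- I)" using assms by simp
    then have "- I \<in> ?R" by (intro CollectI exI[of _ "\<lambda>t. - v t"])
    then show "I \<in> uminus ` ?R" by (rule rev_image_eqI) simp
  next
    fix I assume "I \<in> uminus ` ?R"
    then obtain J u where "I = - J" "\<forall>t\<in>A. - f t \<le> u t" "has u J" by blast
    then have "(\<forall>t\<in>A. - u t \<le> f t) \<and> has (\<lambda>t. - u t) I"
      using assms by (simp add: minus_le_iff)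
    then show "I \<in> ?L" by (intro CollectI exI[of _ "\<lambda>t. - u t"])
  qed
  \<comment> \<open>For reals, \<open>Inf\<close> is defined as the negated \<open>Sup\<close> of
    the negated set.\<close>
  then show ?thesis by (simp add: Inf_real_def)
qed

lemma RDS_lower_eq: "RDS_lower a b \<alpha> f = - RDS_upper a b \<alpha> (\<lambda>t. - f t)"
  unfolding RDS_lower_def RDS_upper_def
  by (intro Sup_eq_uminus_Inf has_RDS_step_integral_uminus)

lemma DS_lower_eq: "DS_lower a b \<alpha> f = - DS_upper a b \<alpha> (\<lambda>t. - f t)"
  unfolding DS_lower_def DS_upper_def
  by (intro Sup_eq_uminus_Inf has_DS_step_integral_uminus)

text \<open>A point determines its pair, so the sum runs over the points with nonzero jump; all
  other points contribute 0.\<close>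

lemma (in stieltjes) infsum_saltus_set_L:
  "(\<Sum>\<^sub>\<infinity>(x, d) \<in> saltus_set_L a b \<alpha>. d * g x) = (\<Sum>\<^sub>\<infinity>t\<in>{a..b}. jump_r t * g t)"
proof -
  let ?A = "{t \<in> {a..b}. jump_r t \<noteq> 0}"
  have "saltus_set_L a b \<alpha> = (\<lambda>t. (t, jump_r t)) ` ?A"
    by (auto simp: saltus_set_L_def jump_r_def)
  then have "(\<Sum>\<^sub>\<infinity>(x, d) \<in> saltus_set_L a b \<alpha>. d * g x) = (\<Sum>\<^sub>\<infinity>t\<in>?A. jump_r t * g t)"
    by (simp add: infsum_reindex inj_on_def o_def)
  also have "\<dots> = (\<Sum>\<^sub>\<infinity>t\<in>{a..b}. jump_r t * g t)"
    by (rule infsum_cong_neutral) auto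
  finally show ?thesis .
qed

lemma (in stieltjes) infsum_saltus_set_R:
  "(\<Sum>\<^sub>\<infinity>(x, d) \<in> saltus_set_R a b \<alpha>. d * g x) = (\<Sum>\<^sub>\<infinity>t\<in>{a..b}. jump_l t * g t)"
proof -
  let ?A = "{t \<in> {a..b}. jump_l t \<noteq> 0}"
  have "saltus_set_R a b \<alpha> = (\<lambda>t. (t, jump_l t)) ` ?A"
    by (auto simp: saltus_set_R_def jump_l_def)
  then have "(\<Sum>\<^sub>\<infinity>(x, d) \<in> saltus_set_R a b \<alpha>. d * g x) = (\<Sum>\<^sub>\<infinity>t\<in>?A. jump_l t * g t)"
    by (simp add: infsum_reindex inj_on_def o_def)
  also have "\<dots> = (\<Sum>\<^sub>\<infinity>t\<in>{a..b}. jump_l t * g t)"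
    by (rule infsum_cong_neutral) auto
  finally show ?thesis .
qed

subsection \<open>The equivalence\<close>

theorem theorem9p3:
  fixes a b :: real and \<alpha> f :: "real \<Rightarrow> real"
  assumes "a < b"
    and "mono_on {a..b} \<alpha>"
    and "bounded (f ` {a..b})"
  shows "(f \<in> DS a b \<alpha> \<and> RDS_integral a b \<alpha> f = DS_integral a b \<alpha> f) \<longleftrightarrow>
    (f \<in> RDS a b \<alpha> \<and>
     (\<forall>(x, d) \<in> saltus_set_L a b \<alpha>. \<exists>l. (f \<longlongrightarrow> l) (at_right x)) \<and>
     (\<forall>(y, e) \<in> saltus_set_R a b \<alpha>. \<exists>l. (f \<longlongrightarrow> l) (at_left y)) \<and>
     (\<Sum>\<^sub>\<infinity>(x, d) \<in> saltus_set_L a b \<alpha>. d * (f x - Lim (at_right x) f))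
       + (\<Sum>\<^sub>\<infinity>(y, e) \<in> saltus_set_R a b \<alpha>. e * (f y - Lim (at_left y) f)) = 0)"
proof -
  obtain K where K: "\<And>t. t \<in> {a..b} \<Longrightarrow> \<bar>f t\<bar> \<le> K"
    using assms(3) unfolding bounded_iff by (metis imageI real_norm_def)
  interpret S: stieltjes a b \<alpha> by unfold_locales (use assms in auto)
  interpret P: stieltjes_bounded a b \<alpha> f K by unfold_locales (rule K)
  \<comment> \<open>\<open>- f\<close> obeys the same bound and gives access to the lower integrals
    of \<open>f\<close>.\<close>
  interpret N: stieltjes_bounded a b \<alpha> "\<lambda>t. - f t" K by unfold_locales (use K in simp)
  let ?sr = "\<lambda>t. real_limsup (at_right t) f" and ?sl = "\<lambda>t. real_limsup (at_left t) f"
  let ?ir = "\<lambda>t. real_limsup (at_right t) (\<lambda>s. - f s)"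
  let ?il = "\<lambda>t. real_limsup (at_left t) (\<lambda>s. - f s)"
  define SP where "SP = infsum P.limsup_gap {a..b}"
  define SN where "SN = infsum N.limsup_gap {a..b}"
  define UD where "UD = DS_upper a b \<alpha> f"
  define LD where "LD = DS_lower a b \<alpha> f"
  define UR where "UR = RDS_upper a b \<alpha> f"
  define LR where "LR = RDS_lower a b \<alpha> f"
  have U: "UD = UR + SP" unfolding UD_def UR_def SP_def by (rule P.DS_upper_eq)
  have L: "LD = LR - SN"
    unfolding LD_def LR_def SN_def RDS_lower_eq DS_lower_eq N.DS_upper_eq by simp
  have LU: "LR \<le> UR" unfolding LR_def UR_def by (rule P.RDS_lower_le_upper)

  \<comment> \<open>Adding the limiting gaps of \<open>f\<close> and \<open>- f\<close> cancels the
    values \<open>f t\<close> and leaves each jump times the one-sided oscillation of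
    \<open>f\<close> on its side.\<close>
  define osc where "osc t = P.limsup_gap t + N.limsup_gap t" for t
  have osc: "osc t = S.jump_r t * (?sr t + ?ir t) + S.jump_l t * (?sl t + ?il t)" for t
    by (simp add: osc_def P.limsup_gap_def N.limsup_gap_def algebra_simps)
  \<comment> \<open>At \<open>t = b\<close> the filter leaves \<open>[a, b]\<close>, where
    \<open>f\<close> is uncontrolled, but the jump vanishes there; elsewhere the oscillation is
    nonnegative.\<close>
  have r0: "0 \<le> S.jump_r t * (?sr t + ?ir t)" if t: "t \<in> {a..b}" for t
    using t S.jump_r_nonneg[OF t] P.eventually_right_bound(1)[of t]
      real_limsup_uminus_ge[of "at_right t" f K]
    by (cases "t = b") (auto simp: trivial_limit_at_right_real)
  have l0: "0 \<le> S.jump_l t * (?sl t + ?il t)" if t: "t \<in> {a..b}" for t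
    using t S.jump_l_nonneg[OF t] P.eventually_left_bound(1)[of t]
      real_limsup_uminus_ge[of "at_left t" f K]
    by (cases "t = a") (auto simp: trivial_limit_at_left_real)
  have osc0: "0 \<le> osc t" if "t \<in> {a..b}" for t using r0[OF that] l0[OF that] by (simp add: osc)
  have osc_sum: "osc summable_on {a..b}" "infsum osc {a..b} = SP + SN"
    unfolding osc_def[abs_def] SP_def SN_def
    by (intro summable_on_add infsum_add P.limsup_gap_summable N.limsup_gap_summable)+
  have SPN: "0 \<le> SP + SN" using infsum_nonneg[of "{a..b}" osc] osc0 osc_sum by simp

  define limits where "limits \<longleftrightarrow>
     (\<forall>(x, d) \<in> saltus_set_L a b \<alpha>. \<exists>l. (f \<longlongrightarrow> l) (at_right x)) \<and>
     (\<forall>(y, e) \<in> saltus_set_R a b \<alpha>. \<exists>l. (f \<longlongrightarrow> l) (at_left y))"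
  have limits_iff: "limits \<longleftrightarrow> (\<forall>t\<in>{a..b}. (S.jump_r t \<noteq> 0 \<longrightarrow> (\<exists>l. (f \<longlongrightarrow> l) (at_right t))) \<and>
      (S.jump_l t \<noteq> 0 \<longrightarrow> (\<exists>l. (f \<longlongrightarrow> l) (at_left t))))"
    by (auto simp: limits_def saltus_set_L_def saltus_set_R_def S.jump_r_def S.jump_l_def)
  \<comment> \<open>Where the limits exist, every oscillation that carries a nonzero jump is
    0.\<close>
  have "SP + SN = 0" if limits
  proof -
    have "osc t = 0" if t: "t \<in> {a..b}" for t
    proof -
      have "S.jump_r t * (?sr t + ?ir t) = 0"
      proof (cases "S.jump_r t = 0")
        case False
        then obtain l where l: "(f \<longlongrightarrow> l) (at_right t)" using \<open>limits\<close> t limits_iff by blast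
        then show ?thesis
          using real_limsup_eq_lim[OF _ l] real_limsup_eq_lim[OF _ tendsto_minus[OF l]]
          by (simp add: trivial_limit_at_right_real)
      qed simp
      moreover have "S.jump_l t * (?sl t + ?il t) = 0"
      proof (cases "S.jump_l t = 0")
        case False
        then obtain l where l: "(f \<longlongrightarrow> l) (at_left t)" using \<open>limits\<close> t limits_iff by blast
        then show ?thesis
          using real_limsup_eq_lim[OF _ l] real_limsup_eq_lim[OF _ tendsto_minus[OF l]]
          by (simp add: trivial_limit_at_left_real)
      qed simp
      ultimately show ?thesis unfolding osc by linarith
    qed
    then show ?thesis using osc_sum(2) infsum_0[of "{a..b}" osc] by simp
  qed
  \<comment> \<open>A vanishing sum of nonnegative terms has vanishing terms, and zero oscillation
    at a nonzero jump forces the limit to exist.\<close>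
  moreover have limits if "SP + SN = 0"
    unfolding limits_iff
  proof (intro ballI conjI impI)
    fix t assume t: "t \<in> {a..b}"
    have "osc t = 0" by (rule nonneg_infsum_le_0D[OF _ osc_sum(1) osc0 t]) (use osc_sum that in auto)
    then have z: "S.jump_r t * (?sr t + ?ir t) = 0" "S.jump_l t * (?sl t + ?il t) = 0"
      using r0[OF t] l0[OF t] unfolding osc by linarith+
    show "\<exists>l. (f \<longlongrightarrow> l) (at_right t)" if "S.jump_r t \<noteq> 0"
    proof -
      have "t < b" using that t by (cases "t = b") auto
      then show ?thesis
        using z(1) that t tendsto_real_limsup[OF P.eventually_right_bound(1)[of t]] by auto
    qed
    show "\<exists>l. (f \<longlongrightarrow> l) (at_left t)" if "S.jump_l t \<noteq> 0"
    proof -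
      have "a < t" using that t by (cases "t = a") auto
      then show ?thesis
        using z(2) that t tendsto_real_limsup[OF P.eventually_left_bound(1)[of t]] by auto
    qed
  qed
  ultimately have limits_SPN: "limits \<longleftrightarrow> SP + SN = 0" by blast

  \<comment> \<open>These bounds make the two parts of \<open>limsup_gap\<close> separately
    summable, as splitting \<open>SP\<close> into two series requires. The lower bound on
    \<open>?sr t\<close> follows from \<open>?ir t \<le> K\<close> and nonnegative
    oscillation.\<close>
  have r_abs: "\<bar>?sr t - f t\<bar> \<le> 2 * K" if t: "t \<in> {a..<b}" for t
  proof -
    have "?sr t \<le> K" "?ir t \<le> K" "0 \<le> ?sr t + ?ir t"
      using t P.eventually_right_bound[of t] N.eventually_right_bound[of t]
      by (auto intro!: real_limsup_le[of _ K] real_limsup_uminus_ge[of _ _ K]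
          simp: trivial_limit_at_right_real)
    then show ?thesis using K[of t] t by auto
  qed
  have l_abs: "\<bar>?sl t - f t\<bar> \<le> 2 * K" if t: "t \<in> {a<..b}" for t
  proof -
    have "?sl t \<le> K" "?il t \<le> K" "0 \<le> ?sl t + ?il t"
      using t P.eventually_left_bound[of t] N.eventually_left_bound[of t]
      by (auto intro!: real_limsup_le[of _ K] real_limsup_uminus_ge[of _ _ K]
          simp: trivial_limit_at_left_real)
    then show ?thesis using K[of t] t by auto
  qed
  have r_bound: "norm (S.jump_r t * (?sr t - f t)) \<le> S.jump_r t * (2 * K)" if t: "t \<in> {a..b}" for t
    using t S.jump_r_nonneg[OF t] r_abs[of t]
    by (cases "t = b") (auto simp: abs_mult intro: mult_left_mono)
  have r_sum: "(\<lambda>t. S.jump_r t * (?sr t - f t)) summable_on {a..b}"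
    by (rule abs_summable_summable,
        rule summable_on_comparison_test[OF summable_on_cmult_left[OF S.jumps_summable(1)]],
        rule r_bound, assumption, rule norm_ge_zero)
  have l_bound: "norm (S.jump_l t * (?sl t - f t)) \<le> S.jump_l t * (2 * K)" if t: "t \<in> {a..b}" for t
    using t S.jump_l_nonneg[OF t] l_abs[of t]
    by (cases "t = a") (auto simp: abs_mult intro: mult_left_mono)
  have l_sum: "(\<lambda>t. S.jump_l t * (?sl t - f t)) summable_on {a..b}"
    by (rule abs_summable_summable,
        rule summable_on_comparison_test[OF summable_on_cmult_left[OF S.jumps_summable(2)]],
        rule l_bound, assumption, rule norm_ge_zero)

  \<comment> \<open>A limit that exists is the upper limit, and points without jump contribute 0, so
    the two series are the negated parts of \<open>SP\<close>.\<close>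
  have sum_eq: "(\<Sum>\<^sub>\<infinity>(x, d) \<in> saltus_set_L a b \<alpha>. d * (f x - Lim (at_right x) f))
       + (\<Sum>\<^sub>\<infinity>(y, e) \<in> saltus_set_R a b \<alpha>. e * (f y - Lim (at_left y) f)) = - SP" if limits
  proof -
    have "S.jump_r t * (f t - Lim (at_right t) f) = - (S.jump_r t * (?sr t - f t))"
      if t: "t \<in> {a..b}" for t
    proof (cases "S.jump_r t = 0")
      case False
      then obtain l where l: "(f \<longlongrightarrow> l) (at_right t)" using \<open>limits\<close> t limits_iff by blast
      then show ?thesis
        using real_limsup_eq_lim[OF _ l] tendsto_Lim[OF _ l]
        by (simp add: trivial_limit_at_right_real algebra_simps)
    qed simp
    then have "(\<Sum>\<^sub>\<infinity>t\<in>{a..b}. S.jump_r t * (f t - Lim (at_right t) f))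
        = - (\<Sum>\<^sub>\<infinity>t\<in>{a..b}. S.jump_r t * (?sr t - f t))"
      unfolding infsum_uminus[symmetric] by (intro infsum_cong)
    moreover have "S.jump_l t * (f t - Lim (at_left t) f) = - (S.jump_l t * (?sl t - f t))"
      if t: "t \<in> {a..b}" for t
    proof (cases "S.jump_l t = 0")
      case False
      then obtain l where l: "(f \<longlongrightarrow> l) (at_left t)" using \<open>limits\<close> t limits_iff by blast
      then show ?thesis
        using real_limsup_eq_lim[OF _ l] tendsto_Lim[OF _ l]
        by (simp add: trivial_limit_at_left_real algebra_simps)
    qed simp
    then have "(\<Sum>\<^sub>\<infinity>t\<in>{a..b}. S.jump_l t * (f t - Lim (at_left t) f))
        = - (\<Sum>\<^sub>\<infinity>t\<in>{a..b}. S.jump_l t * (?sl t - f t))"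
      unfolding infsum_uminus[symmetric] by (intro infsum_cong)
    moreover have "SP = (\<Sum>\<^sub>\<infinity>t\<in>{a..b}. S.jump_r t * (?sr t - f t))
        + (\<Sum>\<^sub>\<infinity>t\<in>{a..b}. S.jump_l t * (?sl t - f t))"
      unfolding SP_def P.limsup_gap_def[abs_def] by (rule infsum_add[OF r_sum l_sum])
    ultimately show ?thesis
      using S.infsum_saltus_set_L[of "\<lambda>x. f x - Lim (at_right x) f"]
        S.infsum_saltus_set_R[of "\<lambda>x. f x - Lim (at_left x) f"] by simp
  qed

  have "f \<in> DS a b \<alpha> \<and> RDS_integral a b \<alpha> f = DS_integral a b \<alpha> f \<longleftrightarrow> LD = UD \<and> LR = LD"
    using assms(3) by (simp add: DS_def RDS_integral_def DS_integral_def LD_def UD_def LR_def)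
  \<comment> \<open>\<open>LD = UD\<close> says that \<open>(UR - LR) + (SP + SN) = 0\<close>, a sum
    of two nonnegative terms; \<open>LR = LD\<close> says \<open>SN = 0\<close>, which then amounts
    to \<open>SP = 0\<close>.\<close>
  also have "\<dots> \<longleftrightarrow> LR = UR \<and> SP + SN = 0 \<and> - SP = 0"
    using U L LU SPN by auto
  also have "\<dots> \<longleftrightarrow> f \<in> RDS a b \<alpha> \<and> limits \<and>
     (\<Sum>\<^sub>\<infinity>(x, d) \<in> saltus_set_L a b \<alpha>. d * (f x - Lim (at_right x) f))
       + (\<Sum>\<^sub>\<infinity>(y, e) \<in> saltus_set_R a b \<alpha>. e * (f y - Lim (at_left y) f)) = 0"
    using assms(3) limits_SPN sum_eq by (auto simp: RDS_def LR_def UR_def)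
  finally show ?thesis unfolding limits_def by blast
qed

end
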